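(* Let $n\ge 2$ be an integer, let $K_{n+1}$ be the complete graph on $[n+1]$, and let $\mathbf{1}$ denote an all-ones vector (of the appropriate length). Then $$\operatorname{vol} \mathcal{F}_{K_{n+1}}(\mathbf{1})=\frac{2^{\binom{n}{2}}}{n!}\, \operatorname{vol} \mathcal{F}_{((n-1,n-2,\ldots,1), \mathbf{1})}^{\lim}.$$
   Context: A partition $\lambda$ is a weakly decreasing finite sequence of positive integers; $\ell(\lambda)$ is its number of parts; $[m]=\{1,\dots,m\}$. Flow polytope: for a graph $G$ on vertex set $[m+1]$ with each edge written $(i,j)$, $i<j$ (directed from $i$ to $j$), and $\mathbf{a}=(a_1,\ldots,a_m)\in\mathbb{Z}^m$, set $a_{m+1}:=-\sum_{i=1}^m a_i$. An $\mathbf{a}$-flow on $G$ is a function $f:E(G)\to\mathbb{R}_{\ge 0}$ with $\sum_{(g,i)\in E(G)} f(g,i)+a_i=\sum_{(i,j)\in E(G)} f(i,j)$ for all $1\le i\le m+1$. The flow polytope $\mathcal{F}_G(\mathbf{a})\subset\mathbb{R}^{E(G)}$ is the set of all $\mathbf{a}$-flows on $G$. So $\mathcal{F}_{K_{n+1}}(\mathbf{1})$ has netflow $(1,\ldots,1,-n)$ on $[n+1]$. The graph $G(\lambda,m)$: for an integer $m$ with $m-i\ge\lambda_i$ for all $i\in[\ell(\lambda)]$, $G(\lambda,m)$ is the graph on $[m+1]$ with edge set $\{(i,m+1): i\in[m]\}\cup\{(i,j): i\in[\ell(\lambda)],\ m+1-\lambda_i\le j\le m\}$. The limiting polytope is $\mathcal{F}_{(\lambda,\mathbf{a})}^{\lim}:=\mathcal{F}_{G(\lambda,\ell(\lambda)+\lambda_1)}(\mathbf{a})$,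 where the netflow $\mathbf{a}$ has $\ell(\lambda)+\lambda_1$ entries. For a $d$-dimensional integer polytope $P\subset\mathbb{R}^p$, the normalized volume $\operatorname{vol}(P)$ is $d!$ times the leading coefficient of its Ehrhart polynomial $t\mapsto\#(tP\cap\mathbb{Z}^p)$; equivalently, it is the volume form on $\operatorname{aff}(P)$ (the affine span of $P$) assigning volume one to the smallest $d$-dimensional integer simplex in $\operatorname{aff}(P)$. *)

theory Defs
  imports "HOL-Analysis.Analysis" "HOL-Analysis.Finite_Function_Topology"
    "HOL-Computational_Algebra.Polynomial"
begin

text \<open>
  A graph on the vertex set \<open>{1..m + 1}\<close> is given by its finite set \<open>E\<close> of edges \<open>(i, j)\<close>,
  \<open>1 \<le> i < j \<le> m + 1\<close>. A point of \<open>\<real>\<^sup>E\<close> is a finitely supported function on pairs that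
  vanishes outside \<open>E\<close>; this embedding respects the vector space structure and the integer
  lattice.
\<close>

type_synonym edge = "nat \<times> nat"

text \<open>
  Netflow vectors are indexed from 1: only \<open>a 1, \<dots>, a m\<close> are used, and the entry at \<open>m + 1\<close> is
  replaced by minus their sum.
\<close>

definition netflow :: "nat \<Rightarrow> (nat \<Rightarrow> int) \<Rightarrow> nat \<Rightarrow> int" where
  "netflow m a i = (if i = m + 1 then - (\<Sum>k = 1..m. a k) else a i)"

definition is_flow :: "nat \<Rightarrow> edge set \<Rightarrow> (nat \<Rightarrow> int) \<Rightarrow> (edge, real) poly_mapping \<Rightarrow> bool" where
  "is_flow m E a f \<longleftrightarrow>
     Poly_Mapping.keys f \<subseteq> E \<and>
     (\<forall>e\<in>E. Poly_Mapping.lookup f e \<ge> 0) \<and>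
     (\<forall>i\<in>{1..m + 1}.
        (\<Sum>g | (g, i) \<in> E. Poly_Mapping.lookup f (g, i)) + of_int (netflow m a i)
          = (\<Sum>j | (i, j) \<in> E. Poly_Mapping.lookup f (i, j)))"

definition flow_polytope :: "nat \<Rightarrow> edge set \<Rightarrow> (nat \<Rightarrow> int) \<Rightarrow> (edge, real) poly_mapping set" where
  "flow_polytope m E a = {f. is_flow m E a f}"

definition complete_edges :: "nat \<Rightarrow> edge set" where
  "complete_edges k = {(i, j). 1 \<le> i \<and> i < j \<and> j \<le> k}"

text \<open>
  A partition is the list of its parts in weakly decreasing order, so its \<open>i\<close>-th part
  (\<open>1 \<le> i \<le> length lam\<close>) is \<open>lam ! (i - 1)\<close>. The graph \<open>G(lam, m)\<close> is meant for
  \<open>i + lam ! (i - 1) \<le> m\<close>, which is automatic for \<open>m = length lam + lam ! 0\<close>.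
\<close>

definition partition_edges :: "nat list \<Rightarrow> nat \<Rightarrow> edge set" where
  "partition_edges lam m =
     {(i, m + 1) | i. i \<in> {1..m}} \<union>
     {(i, j). i \<in> {1..length lam} \<and> m + 1 - lam ! (i - 1) \<le> j \<and> j \<le> m}"

definition limiting_flow_polytope :: "nat list \<Rightarrow> (nat \<Rightarrow> int) \<Rightarrow> (edge, real) poly_mapping set" where
  "limiting_flow_polytope lam a =
     (let m = length lam + lam ! 0 in flow_polytope m (partition_edges lam m) a)"

definition lattice_point_count :: "('a, real) poly_mapping set \<Rightarrow> nat" where
  "lattice_point_count P = card {x \<in> P. \<forall>e. Poly_Mapping.lookup x e \<in> \<int>}"

definition ehrhart_poly :: "('a, real) poly_mapping set \<Rightarrow> real poly" where
  "ehrhart_poly P =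
     (THE p. \<forall>t::nat. t \<ge> 1 \<longrightarrow>
        poly p (real t) = real (lattice_point_count ((\<lambda>x. real t *\<^sub>R x) ` P)))"

text \<open>
  The dimension of a polytope is that of the direction space of its affine span; the library's
  \<open>aff_dim\<close> is restricted to Euclidean spaces given by a type.
\<close>

definition polytope_dim :: "('a::real_vector) set \<Rightarrow> nat" where
  "polytope_dim P = dim {x - y | x y. x \<in> affine hull P \<and> y \<in> affine hull P}"

definition normalized_volume :: "('a, real) poly_mapping set \<Rightarrow> real" where
  "normalized_volume P = fact (polytope_dim P) * lead_coeff (ehrhart_poly P)"

end

theory Submission
  imports Defs
begin

text \<open>
  Let \<open>K S t\<close> be the number of integer flows on the complete graph with netflow \<open>(t, \<dots>, t)\<close>
  that vanish on the sink edges of all \<open>i \<in> S\<close>. Summing conservation over \<open>S\<close> writes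
  \<open>|S| t K S t\<close> through the flow between \<open>S\<close> and its complement. For \<open>i < j\<close> outside \<open>T\<close>, the
  total flow on \<open>(i, j)\<close> over the flows counted by \<open>K (T \<union> {i}) t\<close>, minus that over the flows
  counted by \<open>K (T \<union> {j}) t\<close>, is \<open>K T t - K (T \<union> {i}) t\<close>. Hence the sums \<open>\<Sigma> k\<close> of \<open>K S t\<close> over
  \<open>|S| = k\<close> satisfy
  \<open>(k + 1) t \<Sigma> (k + 1) \<le> ((n - k) choose 2) \<Sigma> k \<le> (k + 1) (t + n) \<Sigma> (k + 1)\<close>.
  This chain leads from all flows (\<open>k = 0\<close>) to the flows on the complete graph with one vertex
  less (\<open>k = n - 1\<close>), so the leading coefficient of the Ehrhart polynomial is
  \<open>2 ^ (n choose 2) / (1! 2! \<dots> n!)\<close>. The limiting polytope is a product of simplices of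
  dimensions \<open>1, \<dots>, n - 1\<close>, with leading coefficient \<open>1 / (1! \<dots> (n - 1)!)\<close>, and both polytopes
  have dimension \<open>n choose 2\<close>.
\<close>

section \<open>Integer flows and polynomiality of their number\<close>

text \<open>One sum over edges, not separate inflow and outflow sums, so that summing over vertices
  is a plain exchange of sums. Integer values serve routings, real values serve points of the
  polytope.\<close>

definition netgain :: "edge set \<Rightarrow> (edge \<Rightarrow> 'a::ab_group_add) \<Rightarrow> nat \<Rightarrow> 'a" where
  "netgain E f u = (\<Sum>e\<in>E. (if snd e = u then f e else 0) - (if fst e = u then f e else 0))"

definition slack :: "edge set \<Rightarrow> (nat \<Rightarrow> nat) \<Rightarrow> (edge \<Rightarrow> int) \<Rightarrow> nat \<Rightarrow> int" where
  "slack E a f u = int (a u) + netgain E f u"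

text \<open>
  When every vertex has an edge to the sink, the flow on that edge is determined by the flow on
  the remaining edges \<open>E\<close>: it is the slack. So an integer flow is a nonnegative function on
  \<open>E\<close> all of whose slacks are nonnegative.
\<close>

definition routings :: "edge set \<Rightarrow> (nat \<Rightarrow> nat) \<Rightarrow> (edge \<Rightarrow> int) set" where
  "routings E a = {f. (\<forall>e. 0 \<le> f e) \<and> (\<forall>e. e \<notin> E \<longrightarrow> f e = 0) \<and> (\<forall>u. 0 \<le> slack E a f u)}"

lemma netgain_cong: "(\<And>e. e \<in> E \<Longrightarrow> f e = g e) \<Longrightarrow> netgain E f u = netgain E g u"
  unfolding netgain_def by (intro sum.cong) auto

lemma netgain_fun_upd:
  assumes "finite E" "e \<in> E"
  shows "netgain E (f(e := x)) u = netgain E f u +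
    ((if snd e = u then x - f e else 0) - (if fst e = u then x - f e else 0))"
proof -
  have "netgain E g u = ((if snd e = u then g e else 0) - (if fst e = u then g e else 0)) + netgain (E - {e}) g u"
    for g :: "edge \<Rightarrow> 'a"
    unfolding netgain_def by (subst sum.remove[OF assms]) simp
  moreover have "netgain (E - {e}) (f(e := x)) u = netgain (E - {e}) f u"
    by (rule netgain_cong) auto
  ultimately show ?thesis
    by (simp only: fun_upd_same) (simp add: algebra_simps)
qed

lemma netgain_insert:
  assumes "finite E" "e \<notin> E"
  shows "netgain (insert e E) f u =
    ((if snd e = u then f e else 0) - (if fst e = u then f e else 0)) + netgain E f u"
  using assms by (simp add: netgain_def)

lemma slack_fun_upd:
  assumes "finite E" "(i, j) \<in> E" "i \<noteq> j"
  shows "slack E a (f((i, j) := x)) u = slack E a f u +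
    (if u = j then x - f (i, j) else if u = i then f (i, j) - x else 0)"
  using assms by (auto simp: slack_def netgain_fun_upd)

lemma netgain_nonpos:
  assumes "u \<notin> snd ` E" "\<And>e. e \<in> E \<Longrightarrow> (0::int) \<le> f e"
  shows "netgain E f u \<le> 0"
  unfolding netgain_def using assms by (intro sum_nonpos) auto

lemma routingsD:
  assumes "f \<in> routings E a"
  shows "0 \<le> f e" "e \<notin> E \<Longrightarrow> f e = 0" "0 \<le> slack E a f u"
  using assms by (simp_all add: routings_def del: split_paired_All)

lemma routingsI:
  assumes "\<And>e. 0 \<le> f e" "\<And>e. e \<notin> E \<Longrightarrow> f e = 0" "\<And>u. 0 \<le> slack E a f u"
  shows "f \<in> routings E a"
  using assms by (simp add: routings_def)

lemma routings_empty: "routings {} a = {\<lambda>_. 0}"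
  by (auto simp: routings_def slack_def netgain_def)

text \<open>
  Since \<open>u\<close> receives no flow through \<open>E\<close>, the amount sent along the new edge is bounded by the
  supply \<open>a u\<close> alone.
\<close>

lemma routings_insert:
  fixes a :: "nat \<Rightarrow> nat"
  assumes "finite E" "(u, v) \<notin> E" "u \<noteq> v" "u \<notin> snd ` E"
  shows "routings (insert (u, v) E) a =
    (\<Union>m\<le>a u. (\<lambda>f. f((u, v) := int m)) ` routings E (a(u := a u - m, v := a v + m)))"
proof -
  have sl: "slack (insert (u, v) E) a (f((u, v) := int m)) w
      = slack E (a(u := a u - m, v := a v + m)) f w" if "m \<le> a u" for f m w
  proof -
    have "netgain E (f((u, v) := int m)) w = netgain E f w"
      using assms(2) by (intro netgain_cong) auto
    then show ?thesis
      using assms that by (simp add: slack_def netgain_insert)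
  qed
  show ?thesis
  proof (intro equalityI subsetI)
    fix f assume f: "f \<in> routings (insert (u, v) E) a"
    define m where "m = nat (f (u, v))"
    define g where "g = f((u, v) := 0)"
    have fm: "f (u, v) = int m"
      using f by (auto simp: m_def routings_def)
    have fg: "f = g((u, v) := int m)"
      by (auto simp: g_def fm)
    have "netgain E f u \<le> 0"
      using assms f by (intro netgain_nonpos) (auto simp: routings_def)
    moreover have "0 \<le> slack (insert (u, v) E) a f u"
      using f by (simp add: routings_def)
    ultimately have le: "m \<le> a u"
      using assms fm by (simp add: slack_def netgain_insert)
    have "g \<in> routings E (a(u := a u - m, v := a v + m))"
    proof -
      have "0 \<le> g e" "e \<notin> E \<Longrightarrow> g e = 0" for e
        using f unfolding routings_def g_def by (cases "e = (u, v)"; fastforce)+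
      moreover have "0 \<le> slack E (a(u := a u - m, v := a v + m)) g w" for w
        using f unfolding sl[OF le, of g, symmetric] fg[symmetric] by (simp add: routings_def)
      ultimately show ?thesis by (simp add: routings_def)
    qed
    then show "f \<in> (\<Union>m\<le>a u. (\<lambda>f. f((u, v) := int m)) ` routings E (a(u := a u - m, v := a v + m)))"
      using le fg by blast
  next
    fix f assume "f \<in> (\<Union>m\<le>a u. (\<lambda>f. f((u, v) := int m)) ` routings E (a(u := a u - m, v := a v + m)))"
    then obtain m g where "m \<le> a u" "f = g((u, v) := int m)"
        "g \<in> routings E (a(u := a u - m, v := a v + m))"
      by blast
    then show "f \<in> routings (insert (u, v) E) a"
      using sl[of m g] unfolding routings_def by simp
  qed
qed

lemma card_routings_insert:
  fixes a :: "nat \<Rightarrow> nat"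
  assumes "finite E" "(u, v) \<notin> E" "u \<noteq> v" "u \<notin> snd ` E"
    and fin: "\<And>b. finite (routings E b)"
  shows "finite (routings (insert (u, v) E) a)"
    and "card (routings (insert (u, v) E) a) =
      (\<Sum>m\<le>a u. card (routings E (a(u := a u - m, v := a v + m))))"
proof -
  note eq = routings_insert[OF assms(1-4), of a]
  show "finite (routings (insert (u, v) E) a)"
    unfolding eq using fin by auto
  have "card (routings (insert (u, v) E) a) =
      (\<Sum>m\<le>a u. card ((\<lambda>f. f((u, v) := int m)) ` routings E (a(u := a u - m, v := a v + m))))"
    unfolding eq
  proof (rule card_UN_disjoint)
    show "\<forall>i\<in>{..a u}. \<forall>j\<in>{..a u}. i \<noteq> j \<longrightarrow>
        (\<lambda>f. f((u, v) := int i)) ` routings E (a(u := a u - i, v := a v + i)) \<inter>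
        (\<lambda>f. f((u, v) := int j)) ` routings E (a(u := a u - j, v := a v + j)) = {}"
      by (auto dest: fun_upd_eqD)
  qed (use fin in auto)
  also have "\<dots> = (\<Sum>m\<le>a u. card (routings E (a(u := a u - m, v := a v + m))))"
  proof (intro sum.cong card_image refl inj_onI)
    fix m f g
    assume "f \<in> routings E (a(u := a u - m, v := a v + m))"
      "g \<in> routings E (a(u := a u - m, v := a v + m))"
      and e: "f((u, v) := int m) = g((u, v) := int m)"
    \<comment> \<open>Both functions vanish at the new edge, so overwriting that value loses
      nothing.\<close>
    then have "f (u, v) = g (u, v)"
      using assms(2) by (auto simp: routings_def)
    then show "f = g"
      using e by (metis fun_upd_triv fun_upd_upd)
  qed
  finally show "card (routings (insert (u, v) E) a) =
      (\<Sum>m\<le>a u. card (routings E (a(u := a u - m, v := a v + m))))" .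
qed

section \<open>Polynomial functions of the netflow vector\<close>

text \<open>Polynomials in all netflow entries at once: adding an edge turns a count at
  \<open>a\<close> into counts at shifted vectors, so an induction confined to constant netflows
  would not close.\<close>

inductive_set poly_funs :: "((nat \<Rightarrow> nat) \<Rightarrow> real) set" where
  const: "(\<lambda>_. c) \<in> poly_funs"
| var: "(\<lambda>a. real (a i)) \<in> poly_funs"
| add: "F \<in> poly_funs \<Longrightarrow> G \<in> poly_funs \<Longrightarrow> (\<lambda>a. F a + G a) \<in> poly_funs"
| mult: "F \<in> poly_funs \<Longrightarrow> G \<in> poly_funs \<Longrightarrow> (\<lambda>a. F a * G a) \<in> poly_funs"

lemma poly_funs_sum:
  "(\<And>k. k \<in> K \<Longrightarrow> F k \<in> poly_funs) \<Longrightarrow> (\<lambda>a. \<Sum>k\<in>K. F k a) \<in> poly_funs"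
  by (induction K rule: infinite_finite_induct) (auto intro: poly_funs.intros)

lemma poly_funs_poly:
  assumes "F \<in> poly_funs" shows "(\<lambda>a. poly p (F a)) \<in> poly_funs"
  using assms by (induction p) (auto intro: poly_funs.intros)

lemma poly_funs_diagonal:
  assumes "F \<in> poly_funs" shows "\<exists>p. \<forall>t. F (\<lambda>_. t) = poly p (real t)"
  using assms
proof induction
  case (const c)
  show ?case by (intro exI[of _ "[:c:]"]) simp
next
  case (var i)
  show ?case by (intro exI[of _ "[:0, 1:]"]) simp
next
  case (add F G)
  then show ?case by (metis poly_add)
next
  case (mult F G)
  then show ?case by (metis poly_mult)
qed

text \<open>Faulhaber: telescoping \<open>(m + 1) ^ Suc k - m ^ Suc k\<close> and expanding
  binomially leaves \<open>Suc k\<close> times the wanted sum plus lower power sums;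
  \<open>p\<close> is the solution of this equation.\<close>

lemma sum_power_poly: "\<exists>p. \<forall>M. (\<Sum>m\<le>M. real m ^ k) = poly p (real M)"
proof (induction k rule: less_induct)
  case (less k)
  then obtain P where P: "\<And>i M. i < k \<Longrightarrow> (\<Sum>m\<le>M. real m ^ i) = poly (P i) (real M)"
    by metis
  define p where
    "p = smult (1 / real (Suc k)) ([:1, 1:] ^ Suc k - (\<Sum>i<k. smult (real (Suc k choose i)) (P i)))"
  have "(\<Sum>m\<le>M. real m ^ k) = poly p (real M)" for M
  proof -
    have "(\<Sum>m\<le>M. real (Suc m) ^ Suc k - real m ^ Suc k) = real (Suc M) ^ Suc k"
      by (induction M) auto
    moreover have "real (Suc m) ^ Suc k - real m ^ Suc k
        = (\<Sum>i<k. real (Suc k choose i) * real m ^ i) + real (Suc k) * real m ^ k" for m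
    proof -
      have "real (Suc m) ^ Suc k = (real m + 1) ^ Suc k" by (simp add: add.commute)
      also have "\<dots> = (\<Sum>i\<le>Suc k. real (Suc k choose i) * real m ^ i)"
        by (subst binomial_ring) simp
      also have "\<dots> = (\<Sum>i<k. real (Suc k choose i) * real m ^ i) + real (Suc k) * real m ^ k
          + real m ^ Suc k"
        by (simp add: lessThan_Suc_atMost[symmetric] del: power_Suc of_nat_Suc)
      finally show ?thesis by simp
    qed
    ultimately have "real (Suc M) ^ Suc k
        = (\<Sum>i<k. real (Suc k choose i) * (\<Sum>m\<le>M. real m ^ i)) + real (Suc k) * (\<Sum>m\<le>M. real m ^ k)"
      by (simp only: sum.distrib sum_distrib_left) (subst sum.swap, simp)
    then show ?thesis
      by (simp add: p_def poly_sum P field_simps del: power_Suc)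
  qed
  then show ?case by blast
qed

text \<open>For \<open>m \<le> a u\<close> the truncated subtraction is exact, so the shifted value
  is a polynomial in \<open>m\<close> with coefficients in \<open>poly_funs\<close>. The degree
  bound, uniform in \<open>a\<close>, reduces the later sum over \<open>m\<close> to a fixed number
  of power sums.\<close>

lemma poly_funs_shift:
  assumes "F \<in> poly_funs"
  shows "\<exists>Q d. (\<forall>a m. m \<le> a u \<longrightarrow> F (a(u := a u - m, v := a v + m)) = poly (Q a) (real m)) \<and>
    (\<forall>a. degree (Q a) \<le> d) \<and> (\<forall>k. (\<lambda>a. coeff (Q a) k) \<in> poly_funs)"
  using assms
proof induction
  case (const c)
  have "(\<lambda>a. coeff [:c:] k) \<in> poly_funs" for k by (rule poly_funs.const)
  then show ?case by (intro exI[of _ "\<lambda>_. [:c:]"] exI[of _ 0]) simp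
next
  case (var i)
  \<comment> \<open>Slope of the \<open>i\<close>-th shifted entry in \<open>m\<close>. Testing
    \<open>v\<close> first matches the update order, where the entry at \<open>v\<close> wins if
    \<open>u = v\<close>.\<close>
  define s :: real where "s = (if i = v then 1 else if i = u then -1 else 0)"
  define Q where "Q a = [:real (a i), s:]" for a :: "nat \<Rightarrow> nat"
  have "(\<lambda>a. coeff (Q a) k) \<in> poly_funs" for k
    unfolding Q_def by (cases k; cases "k - 1") (auto intro: poly_funs.intros simp: coeff_pCons)
  moreover have "degree (Q a) \<le> 1" for a
    by (simp add: Q_def)
  moreover have "real ((a(u := a u - m, v := a v + m)) i) = poly (Q a) (real m)" if "m \<le> a u" for a m
    using that by (auto simp: Q_def s_def of_nat_diff)
  ultimately show ?case
    by (intro exI[of _ Q] exI[of _ 1] conjI allI impI)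
next
  case (add F G)
  from add.IH(1) obtain Q d where
    Q: "\<forall>a m. m \<le> a u \<longrightarrow> F (a(u := a u - m, v := a v + m)) = poly (Q a) (real m)"
      "\<forall>a. degree (Q a) \<le> d" "\<forall>k. (\<lambda>a. coeff (Q a) k) \<in> poly_funs"
    by (elim exE conjE)
  from add.IH(2) obtain R d' where
    R: "\<forall>a m. m \<le> a u \<longrightarrow> G (a(u := a u - m, v := a v + m)) = poly (R a) (real m)"
      "\<forall>a. degree (R a) \<le> d'" "\<forall>k. (\<lambda>a. coeff (R a) k) \<in> poly_funs"
    by (elim exE conjE)
  have "degree (Q a + R a) \<le> max d d'" for a
    using Q(2) R(2) by (intro degree_add_le) (auto simp: le_max_iff_disj)
  moreover have "(\<lambda>a. coeff (Q a + R a) k) \<in> poly_funs" for k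
    unfolding coeff_add using Q(3) R(3) by (intro poly_funs.add) auto
  ultimately show ?case
    using Q(1) R(1)
    by (intro exI[of _ "\<lambda>a. Q a + R a"] exI[of _ "max d d'"]) (simp del: fun_upd_apply)
next
  case (mult F G)
  from mult.IH(1) obtain Q d where
    Q: "\<forall>a m. m \<le> a u \<longrightarrow> F (a(u := a u - m, v := a v + m)) = poly (Q a) (real m)"
      "\<forall>a. degree (Q a) \<le> d" "\<forall>k. (\<lambda>a. coeff (Q a) k) \<in> poly_funs"
    by (elim exE conjE)
  from mult.IH(2) obtain R d' where
    R: "\<forall>a m. m \<le> a u \<longrightarrow> G (a(u := a u - m, v := a v + m)) = poly (R a) (real m)"
      "\<forall>a. degree (R a) \<le> d'" "\<forall>k. (\<lambda>a. coeff (R a) k) \<in> poly_funs"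
    by (elim exE conjE)
  have "degree (Q a * R a) \<le> d + d'" for a
    using Q(2) R(2) by (meson add_mono degree_mult_le order_trans)
  moreover have "(\<lambda>a. coeff (Q a * R a) k) \<in> poly_funs" for k
    unfolding coeff_mult using Q(3) R(3) by (intro poly_funs_sum poly_funs.mult) auto
  ultimately show ?case
    using Q(1) R(1)
    by (intro exI[of _ "\<lambda>a. Q a * R a"] exI[of _ "d + d'"]) (simp del: fun_upd_apply)
qed

lemma poly_funs_sum_shift:
  assumes "F \<in> poly_funs"
  shows "(\<lambda>a. \<Sum>m\<le>a u. F (a(u := a u - m, v := a v + m))) \<in> poly_funs"
proof -
  obtain Q d where Q: "\<And>a m. m \<le> a u \<Longrightarrow> F (a(u := a u - m, v := a v + m)) = poly (Q a) (real m)"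
    "\<And>a. degree (Q a) \<le> d" "\<And>k. (\<lambda>a. coeff (Q a) k) \<in> poly_funs"
    using poly_funs_shift[OF assms, of u v] by metis
  obtain P where P: "\<And>k M. (\<Sum>m\<le>M. real m ^ k) = poly (P k) (real M)"
    using sum_power_poly by metis
  have "(\<Sum>m\<le>a u. F (a(u := a u - m, v := a v + m)))
      = (\<Sum>k\<le>d. coeff (Q a) k * poly (P k) (real (a u)))" for a
  proof -
    have "poly (Q a) x = (\<Sum>k\<le>d. coeff (Q a) k * x ^ k)" for x
      unfolding poly_altdef using Q(2)[of a]
      by (intro sum.mono_neutral_left) (auto simp: coeff_eq_0)
    then have "(\<Sum>m\<le>a u. F (a(u := a u - m, v := a v + m)))
        = (\<Sum>m\<le>a u. \<Sum>k\<le>d. coeff (Q a) k * real m ^ k)"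
      using Q(1) by simp
    also have "\<dots> = (\<Sum>k\<le>d. coeff (Q a) k * poly (P k) (real (a u)))"
      by (subst sum.swap) (simp flip: P add: sum_distrib_left)
    finally show ?thesis .
  qed
  moreover have "(\<lambda>a. \<Sum>k\<le>d. coeff (Q a) k * poly (P k) (real (a u))) \<in> poly_funs"
    using Q(3) by (intro poly_funs_sum poly_funs.mult poly_funs_poly poly_funs.var)
  ultimately show ?thesis by simp
qed

text \<open>Ranking by \<open>- int (fst e)\<close> inserts edges of smallest tail last: the new
  tail \<open>u\<close> is at most every tail in \<open>E\<close>, hence below every head, as the
  insertion lemma requires.\<close>

lemma card_routings_poly_funs:
  assumes "finite E" "\<And>e. e \<in> E \<Longrightarrow> fst e < snd e"
  shows "(\<forall>a. finite (routings E a)) \<and> (\<lambda>a. real (card (routings E a))) \<in> poly_funs"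
  using assms
proof (induction "E" rule: finite_ranking_induct[where f = "\<lambda>e. - int (fst e)"])
  case empty
  show ?case by (auto simp: routings_empty intro: poly_funs.const)
next
  case (insert e E)
  show ?case
  proof (cases "e \<in> E")
    case True
    then show ?thesis using insert by (simp add: insert_absorb)
  next
    case False
    obtain u v where e: "e = (u, v)" by fastforce
    have uv: "u \<noteq> v" and u: "u \<notin> snd ` E"
      using insert.prems[of e] insert.prems insert.hyps(2) e by force+
    have IH: "\<And>a. finite (routings E a)" "(\<lambda>a. real (card (routings E a))) \<in> poly_funs"
      using insert by auto
    note card = card_routings_insert[OF insert.hyps(1) False[unfolded e] uv u IH(1)]
    show ?thesis
      unfolding e using card(1) poly_funs_sum_shift[OF IH(2), of u v]
      by (simp add: card(2))
  qed
qed

text \<open>Vertices of \<open>U\<close> receive no flow, so each \<open>u\<close> independently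
  distributes its supply over its \<open>d\<close> edges and the sink edge, in
  \<open>(a u + d) choose d\<close> ways; all other vertices have only the sink edge left.\<close>

lemma card_routings_bipartite:
  assumes "finite E" "finite U" "fst ` E \<subseteq> U" "snd ` E \<inter> U = {}"
  shows "(\<forall>a. finite (routings E a)) \<and> (\<forall>a. card (routings E a) =
    (\<Prod>u\<in>U. (a u + card {e \<in> E. fst e = u}) choose card {e \<in> E. fst e = u}))"
  using assms
proof (induction E)
  case empty
  show ?case by (auto simp: routings_empty)
next
  case (insert e E)
  obtain u v where e: "e = (u, v)" by fastforce
  have uv: "u \<in> U" "v \<notin> U" "u \<noteq> v" "u \<notin> snd ` E" and new: "(u, v) \<notin> E"
    using insert e by auto
  define d where "d w = card {e \<in> E. fst e = w}" for w
  have fin: "\<And>a. finite (routings E a)"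
    and IH: "\<And>a. card (routings E a) = (\<Prod>w\<in>U. (a w + d w) choose d w)"
    using insert by (auto simp: d_def)
  note card = card_routings_insert[OF insert.hyps(1) new uv(3,4) fin]
  have d': "card {e' \<in> insert e E. fst e' = w} = (if w = u then Suc (d w) else d w)" for w
  proof (cases "w = u")
    case True
    then have "{e' \<in> insert e E. fst e' = w} = insert e {e' \<in> E. fst e' = w}" using e by auto
    then show ?thesis using True insert.hyps by (simp add: d_def)
  next
    case False
    then have "{e' \<in> insert e E. fst e' = w} = {e' \<in> E. fst e' = w}" using e by auto
    then show ?thesis using False by (simp add: d_def)
  qed
  have "card (routings (insert e E) a) =
    (\<Prod>w\<in>U. (a w + card {e' \<in> insert e E. fst e' = w}) choose card {e' \<in> insert e E. fst e' = w})" for a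
  proof -
    define R where "R = (\<Prod>w\<in>U - {u}. (a w + d w) choose d w)"
    have "card (routings E (a(u := a u - m, v := a v + m))) = ((a u - m + d u) choose d u) * R" for m
    proof -
      have "(\<Prod>w\<in>U - {u}. ((a(u := a u - m, v := a v + m)) w + d w) choose d w) = R"
        unfolding R_def using uv by (intro prod.cong refl) (metis DiffE fun_upd_other singletonI)
      then show ?thesis
        unfolding IH using uv insert.prems(1) by (subst prod.remove[of U u]) auto
    qed
    then have "card (routings (insert e E) a) = (\<Sum>m\<le>a u. (a u - m + d u) choose d u) * R"
      unfolding e card(2) by (simp add: sum_distrib_right)
    also have "(\<Sum>m\<le>a u. (a u - m + d u) choose d u) = (\<Sum>m\<le>a u. (m + d u) choose d u)"
      by (rule sum.reindex_bij_witness[of _ "\<lambda>m. a u - m" "\<lambda>m. a u - m"]) auto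
    \<comment> \<open>Hockey-stick identity.\<close>
    also have "\<dots> = (a u + Suc (d u)) choose Suc (d u)"
    proof -
      have "(\<Sum>m\<le>M. (m + k) choose k) = (M + Suc k) choose Suc k" for M k
        by (induction M) auto
      then show ?thesis .
    qed
    finally show ?thesis
      unfolding d' using uv insert.prems(1)
      by (subst prod.remove[of U u]) (auto simp: R_def intro!: prod.cong)
  qed
  then show ?case
    unfolding e using card(1) by blast
qed

section \<open>Tight vertices\<close>

text \<open>Zero slack is zero flow on the sink edge; for constant netflow on the complete graph
  these are the flows counted by \<open>K S t\<close>.\<close>

definition tight :: "edge set \<Rightarrow> (nat \<Rightarrow> nat) \<Rightarrow> nat set \<Rightarrow> (edge \<Rightarrow> int) set" where
  "tight E a S = {f \<in> routings E a. \<forall>i\<in>S. slack E a f i = 0}"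

lemma routings_fun_upd:
  assumes "finite E" "(i, j) \<in> E" "i \<noteq> j" "f \<in> routings E a"
    and "0 \<le> x" "0 \<le> slack E a f i + f (i, j) - x" "0 \<le> slack E a f j + x - f (i, j)"
  shows "f((i, j) := x) \<in> routings E a"
  using assms(2,4-) slack_fun_upd[OF assms(1-3), of a f x] by (auto simp: routings_def)

text \<open>
  Changing only the flow on \<open>(i, j)\<close> shifts weight between the slacks of \<open>i\<close> and \<open>j\<close>. The pairs
  \<open>(f, x)\<close> with \<open>0 \<le> x \<le> f (i, j)\<close> and the slack of \<open>i\<close> zero are split according to
  whether lowering \<open>f (i, j)\<close> by \<open>x\<close> keeps the slack of \<open>j\<close> nonnegative.
\<close>

lemma tight_exchange:
  assumes E: "finite E" "(i, j) \<in> E" "i \<noteq> j" and S: "i \<notin> S" "j \<notin> S"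
    and fin: "finite (routings E a)"
  shows "(\<Sum>f\<in>tight E a (insert i S). f (i, j) + 1)
    = int (card (tight E a S)) + (\<Sum>f\<in>tight E a (insert j S). f (i, j))"
proof -
  let ?s = "slack E a"
  \<comment> \<open>The interval from 0 gives \<open>f (i, j) + 1\<close> choices, the one from 1 in
    \<open>B\<close> gives \<open>f (i, j)\<close>: these are the weights in the two sums.\<close>
  define A where "A = (SIGMA f:tight E a (insert i S). {0..f (i, j)})"
  define B where "B = (SIGMA f:tight E a (insert j S). {1..f (i, j)})"
  define A1 where "A1 = {(f, x) \<in> A. x \<le> ?s f j}"
  define A2 where "A2 = {(f, x) \<in> A. ?s f j < x}"
  note sl = slack_fun_upd[OF E] and upd = routings_fun_upd[OF E]
  have fin_tight: "finite (tight E a T)" for T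
    using fin by (simp add: tight_def)
  have tight_mem: "f \<in> tight E a T \<Longrightarrow> f \<in> routings E a" for f T
    by (simp add: tight_def)
  have nonneg: "0 \<le> f e" "0 \<le> ?s f u" if "f \<in> routings E a" for f e u
    using that by (simp_all add: routingsD)
  have other: "u \<noteq> i \<and> u \<noteq> j" if "u \<in> S" for u
    using S that by auto
  have upd_S: "\<forall>u\<in>S. ?s (f((i, j) := x)) u = ?s f u" for f x
    using other by (simp add: sl)
  \<comment> \<open>Move the whole slack of \<open>i\<close> onto the edge and record its amount
    \<open>x\<close>; the slack of \<open>j\<close> is then at least \<open>x\<close>, which is the
    condition of \<open>A1\<close>.\<close>
  have "bij_betw (\<lambda>g. (g((i, j) := g (i, j) + ?s g i), ?s g i)) (tight E a S) A1"
  proof (rule bij_betw_byWitness[where f' = "\<lambda>(f, x). f((i, j) := f (i, j) - x)"])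
    show "\<forall>g\<in>tight E a S. (case (g((i, j) := g (i, j) + ?s g i), ?s g i) of
        (f, x) \<Rightarrow> f((i, j) := f (i, j) - x)) = g"
      by auto
    show "\<forall>p\<in>A1. ((case p of (f, x) \<Rightarrow> f((i, j) := f (i, j) - x))
        ((i, j) := (case p of (f, x) \<Rightarrow> f((i, j) := f (i, j) - x)) (i, j)
          + ?s (case p of (f, x) \<Rightarrow> f((i, j) := f (i, j) - x)) i),
        ?s (case p of (f, x) \<Rightarrow> f((i, j) := f (i, j) - x)) i) = p"
      using E(3) by (auto simp: A1_def A_def tight_def sl)
    have "(g((i, j) := g (i, j) + ?s g i), ?s g i) \<in> A1" if "g \<in> tight E a S" for g
    proof -
      have g: "g \<in> routings E a" "\<forall>u\<in>S. ?s g u = 0"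
        using that by (auto simp: tight_def)
      have "g((i, j) := g (i, j) + ?s g i) \<in> tight E a (insert i S)"
        using g upd[OF g(1)] nonneg[OF g(1)] upd_S[of g] E(3) by (simp add: tight_def sl)
      then show ?thesis
        using nonneg[OF g(1)] E(3) by (simp add: A1_def A_def sl)
    qed
    then show "(\<lambda>g. (g((i, j) := g (i, j) + ?s g i), ?s g i)) ` tight E a S \<subseteq> A1"
      by blast
    have "f((i, j) := f (i, j) - x) \<in> tight E a S" if "(f, x) \<in> A1" for f x
      using that upd[of f a "f (i, j) - x"] upd_S[of f]
      by (simp add: A1_def A_def tight_def)
    then show "(\<lambda>(f, x). f((i, j) := f (i, j) - x)) ` A1 \<subseteq> tight E a S"
      by (auto simp del: fun_upd_apply)
  qed
  then have c1: "card (tight E a S) = card A1"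
    by (rule bij_betw_same_card)
  \<comment> \<open>If \<open>x\<close> exceeds the slack of \<open>j\<close>, lower the edge by
    exactly that slack: \<open>j\<close> becomes tight, and the positive rest of \<open>x\<close> is
    the second component in \<open>B\<close>.\<close>
  have "bij_betw (\<lambda>(h, y). (h((i, j) := h (i, j) + ?s h i), y + ?s h i)) B A2"
  proof (rule bij_betw_byWitness[where f' = "\<lambda>(f, x). (f((i, j) := f (i, j) - ?s f j), x - ?s f j)"])
    show "\<forall>p\<in>B. (case (case p of (h, y) \<Rightarrow> (h((i, j) := h (i, j) + ?s h i), y + ?s h i)) of
        (f, x) \<Rightarrow> (f((i, j) := f (i, j) - ?s f j), x - ?s f j)) = p"
      using E(3) by (auto simp: B_def tight_def sl)
    show "\<forall>p\<in>A2. (case (case p of (f, x) \<Rightarrow> (f((i, j) := f (i, j) - ?s f j), x - ?s f j)) of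
        (h, y) \<Rightarrow> (h((i, j) := h (i, j) + ?s h i), y + ?s h i)) = p"
      using E(3) by (auto simp: A2_def A_def tight_def sl)
    have "(h((i, j) := h (i, j) + ?s h i), y + ?s h i) \<in> A2" if "(h, y) \<in> B" for h y
    proof -
      have h: "h \<in> routings E a" "\<forall>u\<in>insert j S. ?s h u = 0" "1 \<le> y" "y \<le> h (i, j)"
        using that by (auto simp: tight_def B_def)
      have "h((i, j) := h (i, j) + ?s h i) \<in> tight E a (insert i S)"
        using h upd[OF h(1)] nonneg[OF h(1)] upd_S[of h] E(3) by (simp add: tight_def sl)
      then show ?thesis
        using h nonneg[OF h(1)] E(3) by (simp add: A2_def A_def sl)
    qed
    then show "(\<lambda>(h, y). (h((i, j) := h (i, j) + ?s h i), y + ?s h i)) ` B \<subseteq> A2"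
      by (auto simp del: fun_upd_apply)
    have "(f((i, j) := f (i, j) - ?s f j), x - ?s f j) \<in> B" if "(f, x) \<in> A2" for f x
    proof -
      have f: "f \<in> routings E a" "\<forall>u\<in>insert i S. ?s f u = 0" "x \<le> f (i, j)" "?s f j < x"
        using that by (auto simp: tight_def A2_def A_def)
      have "f((i, j) := f (i, j) - ?s f j) \<in> tight E a (insert j S)"
        using f upd[OF f(1)] nonneg[OF f(1)] upd_S[of f] E(3) by (simp add: tight_def sl)
      then show ?thesis
        using f by (simp add: B_def)
    qed
    then show "(\<lambda>(f, x). (f((i, j) := f (i, j) - ?s f j), x - ?s f j)) ` A2 \<subseteq> B"
      by (auto simp del: fun_upd_apply)
  qed
  then have c2: "card B = card A2"
    by (rule bij_betw_same_card)
  have finA: "finite A"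
    unfolding A_def using fin_tight by auto
  have "A = A1 \<union> A2" "A1 \<inter> A2 = {}"
    by (auto simp: A1_def A2_def)
  then have "card A = card A1 + card A2"
    using finA by (metis card_Un_disjoint finite_Un)
  moreover have "int (card A) = (\<Sum>f\<in>tight E a (insert i S). f (i, j) + 1)"
    unfolding A_def using fin_tight nonneg
    by (subst card_SigmaI) (auto intro!: sum.cong dest: tight_mem)
  moreover have "int (card B) = (\<Sum>f\<in>tight E a (insert j S). f (i, j))"
    unfolding B_def using fin_tight nonneg
    by (subst card_SigmaI) (auto intro!: sum.cong dest: tight_mem)
  ultimately show ?thesis
    using c1 c2 by simp
qed

section \<open>Double counting over vertex subsets\<close>

text \<open>An edge with both ends in \<open>S\<close> is gained at one end and lost at the other,
  so only boundary edges survive.\<close>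

lemma sum_netgain:
  assumes "finite S"
  shows "(\<Sum>i\<in>S. netgain E f i) = (\<Sum>e\<in>E. (if snd e \<in> S \<and> fst e \<notin> S then f e else 0)
    - (if fst e \<in> S \<and> snd e \<notin> S then f e else 0))"
proof -
  have "(\<Sum>i\<in>S. netgain E f i)
      = (\<Sum>e\<in>E. \<Sum>i\<in>S. (if snd e = i then f e else 0) - (if fst e = i then f e else 0))"
    unfolding netgain_def by (rule sum.swap)
  also have "\<dots> = (\<Sum>e\<in>E. (if snd e \<in> S \<and> fst e \<notin> S then f e else 0)
    - (if fst e \<in> S \<and> snd e \<notin> S then f e else 0))"
    using assms by (intro sum.cong refl) (simp add: sum_subtractf)
  finally show ?thesis .
qed

lemma card_tight_conservation:
  assumes "finite E" "finite S" "finite (routings E (\<lambda>_. t))"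
  shows "int (card S * t * card (tight E (\<lambda>_. t) S)) =
    (\<Sum>e\<in>E. (if fst e \<in> S \<and> snd e \<notin> S then \<Sum>f\<in>tight E (\<lambda>_. t) S. f e else 0)
      - (if snd e \<in> S \<and> fst e \<notin> S then \<Sum>f\<in>tight E (\<lambda>_. t) S. f e else 0))"
proof -
  have "int (card S * t) = (\<Sum>e\<in>E. (if fst e \<in> S \<and> snd e \<notin> S then f e else 0)
      - (if snd e \<in> S \<and> fst e \<notin> S then f e else 0))" if "f \<in> tight E (\<lambda>_. t) S" for f
  proof -
    have "0 = (\<Sum>i\<in>S. slack E (\<lambda>_. t) f i)"
      using that by (simp add: tight_def)
    also have "\<dots> = int (card S * t) + (\<Sum>i\<in>S. netgain E f i)"
      by (simp add: slack_def sum.distrib)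
    finally show ?thesis
      unfolding sum_netgain[OF assms(2)] by (simp add: sum_subtractf)
  qed
  then have "(\<Sum>f\<in>tight E (\<lambda>_. t) S. int (card S * t)) =
    (\<Sum>f\<in>tight E (\<lambda>_. t) S. \<Sum>e\<in>E. (if fst e \<in> S \<and> snd e \<notin> S then f e else 0)
      - (if snd e \<in> S \<and> fst e \<notin> S then f e else 0))"
    by (rule sum.cong[OF refl])
  also have "\<dots> = (\<Sum>e\<in>E. \<Sum>f\<in>tight E (\<lambda>_. t) S. (if fst e \<in> S \<and> snd e \<notin> S then f e else 0)
      - (if snd e \<in> S \<and> fst e \<notin> S then f e else 0))"
    by (rule sum.swap)
  also have "\<dots> = (\<Sum>e\<in>E. (if fst e \<in> S \<and> snd e \<notin> S then \<Sum>f\<in>tight E (\<lambda>_. t) S. f e else 0)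
      - (if snd e \<in> S \<and> fst e \<notin> S then \<Sum>f\<in>tight E (\<lambda>_. t) S. f e else 0))"
    by (intro sum.cong refl) (auto simp: sum_negf)
  finally show ?thesis
    by (simp add: mult_ac)
qed

text \<open>The bijection removes \<open>i\<close>. Used with either end of an edge as
  \<open>i\<close>, it brings both boundary terms to the same sets avoiding both ends, where the
  exchange lemma applies.\<close>

lemma sum_card_Suc_subsets:
  assumes "finite V" "i \<in> V" "i \<noteq> j"
  shows "(\<Sum>S | S \<subseteq> V \<and> card S = Suc k. if i \<in> S \<and> j \<notin> S then g S else 0)
    = (\<Sum>S | S \<subseteq> V \<and> card S = k. if i \<notin> S \<and> j \<notin> S then g (insert i S) else (0::int))"
proof -
  have fin: "finite {S. S \<subseteq> V \<and> card S = m}" for m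
    using assms(1) by simp
  have "(\<Sum>S | S \<subseteq> V \<and> card S = Suc k. if i \<in> S \<and> j \<notin> S then g S else 0)
      = (\<Sum>S\<in>{S \<in> {S. S \<subseteq> V \<and> card S = Suc k}. i \<in> S \<and> j \<notin> S}. g S)"
    by (rule sum.inter_filter[OF fin, symmetric])
  also have "\<dots> = (\<Sum>S\<in>{S \<in> {S. S \<subseteq> V \<and> card S = k}. i \<notin> S \<and> j \<notin> S}. g (insert i S))"
  proof (rule sum.reindex_bij_witness[of _ "insert i" "\<lambda>S. S - {i}"])
    fix S assume "S \<in> {S \<in> {S. S \<subseteq> V \<and> card S = k}. i \<notin> S \<and> j \<notin> S}"
    then have S: "S \<subseteq> V" "card S = k" "i \<notin> S" "j \<notin> S" "finite S"
      using finite_subset[OF _ assms(1)] by blast+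
    show "insert i S - {i} = S"
      using S(3) by simp
    show "insert i S \<in> {S \<in> {S. S \<subseteq> V \<and> card S = Suc k}. i \<in> S \<and> j \<notin> S}"
      using S assms by simp
  qed (auto simp: insert_absorb)
  also have "\<dots> = (\<Sum>S | S \<subseteq> V \<and> card S = k. if i \<notin> S \<and> j \<notin> S then g (insert i S) else 0)"
    by (rule sum.inter_filter[OF fin])
  finally show ?thesis .
qed

lemma card_pairs_less:
  fixes W :: "nat set"
  assumes "finite W"
  shows "card {(i, j). i \<in> W \<and> j \<in> W \<and> i < j} = card W choose 2"
  using assms
proof (induction W rule: finite_linorder_max_induct)
  case empty
  then show ?case by simp
next
  case (insert b W)
  have "{(i, j). i \<in> insert b W \<and> j \<in> insert b W \<and> i < j}
      = {(i, j). i \<in> W \<and> j \<in> W \<and> i < j} \<union> W \<times> {b}"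
    using insert.hyps(2) less_imp_not_less by auto
  moreover have "finite {(i, j). i \<in> W \<and> j \<in> W \<and> i < j}"
    by (rule finite_subset[of _ "W \<times> W"]) (use insert in auto)
  moreover have "b \<notin> W"
    using insert.hyps(2) by blast
  ultimately have "card {(i, j). i \<in> insert b W \<and> j \<in> insert b W \<and> i < j}
      = (card W choose 2) + card W"
    using insert.hyps(1) insert.IH by (simp only:) (subst card_Un_disjoint, auto)
  then show ?case
    using insert.hyps(1) \<open>b \<notin> W\<close> by (simp add: numeral_2_eq_2)
qed

lemma finite_complete_edges: "finite (complete_edges n)"
  by (rule finite_subset[of _ "{1..n} \<times> {1..n}"]) (auto simp: complete_edges_def)

lemma finite_routings_complete: "finite (routings (complete_edges n) a)"
proof -
  have "fst e < snd e" if "e \<in> complete_edges n" for e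
    using that by (auto simp: complete_edges_def)
  then show ?thesis
    using card_routings_poly_funs[OF finite_complete_edges] by blast
qed

text \<open>The sum \<Sigma> k of the overview; \<open>complete_edges n\<close> are the edges of the
  complete graph on \<open>n + 1\<close> vertices that avoid the sink.\<close>

definition tight_sum :: "nat \<Rightarrow> nat \<Rightarrow> nat \<Rightarrow> nat" where
  "tight_sum n t k =
    (\<Sum>S | S \<subseteq> {1..n} \<and> card S = k. card (tight (complete_edges n) (\<lambda>_. t) S))"

lemma sum_if_const:
  assumes "finite E"
  shows "(\<Sum>e\<in>E. if P e then c else 0) = int (card {e \<in> E. P e}) * c"
  by (subst sum.inter_filter[OF assms, symmetric]) simp

text \<open>Exact form of the chain inequality, with the number of edges leaving \<open>S\<close> as
  the only error term. Conservation is summed over all \<open>S\<close>, the exchange lemma is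
  applied edge by edge, and the terms \<open>K (insert (fst e) S)\<close> are reindexed back and
  moved to the left.\<close>

lemma tight_sum_identity:
  "(\<Sum>S | S \<subseteq> {1..n} \<and> card S = Suc k.
      (Suc k * t + card {e \<in> complete_edges n. fst e \<in> S \<and> snd e \<notin> S})
        * card (tight (complete_edges n) (\<lambda>_. t) S))
    = ((n - k) choose 2) * tight_sum n t k"
proof -
  define E where "E = complete_edges n"
  define K where "K S = int (card (tight E (\<lambda>_. t) S))" for S
  define M where "M S e = (\<Sum>f\<in>tight E (\<lambda>_. t) S. f e)" for S e
  define C where "C m = {S. S \<subseteq> {1..n} \<and> card S = m}" for m
  have finE: "finite E" and finR: "finite (routings E a)" for a
    by (simp_all add: E_def finite_complete_edges finite_routings_complete)
  have E: "fst e \<in> {1..n}" "snd e \<in> {1..n}" "fst e < snd e" if "e \<in> E" for e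
    using that by (auto simp: E_def complete_edges_def)
  have finC: "finite S" if "S \<in> C m" for S m
    using that by (auto simp: C_def intro: finite_subset)
  have exch: "M (insert (fst e) S) e - M (insert (snd e) S) e = K S - K (insert (fst e) S)"
    if "e \<in> E" "fst e \<notin> S" "snd e \<notin> S" for e S
    using tight_exchange[OF finE, of "fst e" "snd e" S "\<lambda>_. t"] that E(3)[OF that(1)] finR
    by (simp add: M_def K_def sum.distrib)
  have "(\<Sum>S\<in>C (Suc k). int (Suc k * t) * K S) = (\<Sum>S\<in>C (Suc k). \<Sum>e\<in>E.
      (if fst e \<in> S \<and> snd e \<notin> S then M S e else 0) - (if snd e \<in> S \<and> fst e \<notin> S then M S e else 0))"
  proof (rule sum.cong[OF refl])
    fix S assume S: "S \<in> C (Suc k)"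
    then have "card S = Suc k" by (simp add: C_def)
    then show "int (Suc k * t) * K S = (\<Sum>e\<in>E.
      (if fst e \<in> S \<and> snd e \<notin> S then M S e else 0) - (if snd e \<in> S \<and> fst e \<notin> S then M S e else 0))"
      using card_tight_conservation[OF finE finC[OF S] finR, of t] unfolding M_def K_def of_nat_mult by simp
  qed
  also have "\<dots> = (\<Sum>e\<in>E. (\<Sum>S\<in>C (Suc k). if fst e \<in> S \<and> snd e \<notin> S then M S e else 0)
      - (\<Sum>S\<in>C (Suc k). if snd e \<in> S \<and> fst e \<notin> S then M S e else 0))"
    by (subst sum.swap) (simp add: sum_subtractf)
  also have "\<dots> = (\<Sum>e\<in>E. \<Sum>S\<in>C k. if fst e \<notin> S \<and> snd e \<notin> S then K S - K (insert (fst e) S) else 0)"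
  proof (rule sum.cong[OF refl])
    fix e assume e: "e \<in> E"
    have "(\<Sum>S\<in>C (Suc k). if fst e \<in> S \<and> snd e \<notin> S then M S e else 0)
      - (\<Sum>S\<in>C (Suc k). if snd e \<in> S \<and> fst e \<notin> S then M S e else 0)
      = (\<Sum>S\<in>C k. if fst e \<notin> S \<and> snd e \<notin> S then M (insert (fst e) S) e else 0)
      - (\<Sum>S\<in>C k. if snd e \<notin> S \<and> fst e \<notin> S then M (insert (snd e) S) e else 0)"
      unfolding C_def using E[OF e] by (subst (1 2) sum_card_Suc_subsets) auto
    also have "\<dots> = (\<Sum>S\<in>C k. if fst e \<notin> S \<and> snd e \<notin> S then K S - K (insert (fst e) S) else 0)"
      unfolding sum_subtractf[symmetric] using exch[OF e] by (intro sum.cong) auto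
    finally show "(\<Sum>S\<in>C (Suc k). if fst e \<in> S \<and> snd e \<notin> S then M S e else 0)
      - (\<Sum>S\<in>C (Suc k). if snd e \<in> S \<and> fst e \<notin> S then M S e else 0)
      = (\<Sum>S\<in>C k. if fst e \<notin> S \<and> snd e \<notin> S then K S - K (insert (fst e) S) else 0)" .
  qed
  also have "\<dots> = (\<Sum>e\<in>E. \<Sum>S\<in>C k. if fst e \<notin> S \<and> snd e \<notin> S then K S else 0)
      - (\<Sum>e\<in>E. \<Sum>S\<in>C k. if fst e \<notin> S \<and> snd e \<notin> S then K (insert (fst e) S) else 0)"
    unfolding sum_subtractf[symmetric] by (intro sum.cong) auto
  also have "(\<Sum>e\<in>E. \<Sum>S\<in>C k. if fst e \<notin> S \<and> snd e \<notin> S then K (insert (fst e) S) else 0)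
      = (\<Sum>e\<in>E. \<Sum>S\<in>C (Suc k). if fst e \<in> S \<and> snd e \<notin> S then K S else 0)"
  proof (rule sum.cong[OF refl])
    fix e assume "e \<in> E"
    from E[OF this] show "(\<Sum>S\<in>C k. if fst e \<notin> S \<and> snd e \<notin> S then K (insert (fst e) S) else 0)
      = (\<Sum>S\<in>C (Suc k). if fst e \<in> S \<and> snd e \<notin> S then K S else 0)"
      unfolding C_def by (intro sum_card_Suc_subsets[symmetric]) auto
  qed
  also have "\<dots> = (\<Sum>S\<in>C (Suc k). int (card {e \<in> E. fst e \<in> S \<and> snd e \<notin> S}) * K S)"
    by (subst sum.swap) (simp only: sum_if_const[OF finE])
  also have "(\<Sum>e\<in>E. \<Sum>S\<in>C k. if fst e \<notin> S \<and> snd e \<notin> S then K S else 0)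
      = (\<Sum>S\<in>C k. int (card {e \<in> E. fst e \<notin> S \<and> snd e \<notin> S}) * K S)"
    by (subst sum.swap) (simp only: sum_if_const[OF finE])
  also have "\<dots> = (\<Sum>S\<in>C k. int ((n - k) choose 2) * K S)"
  proof (intro sum.cong refl)
    fix S assume S: "S \<in> C k"
    have "{e \<in> E. fst e \<notin> S \<and> snd e \<notin> S} = {(i, j). i \<in> {1..n} - S \<and> j \<in> {1..n} - S \<and> i < j}"
      by (auto simp: E_def complete_edges_def)
    moreover have "card ({1..n} - S) = n - k"
      using S finC[OF S] by (simp add: C_def card_Diff_subset)
    ultimately show "int (card {e \<in> E. fst e \<notin> S \<and> snd e \<notin> S}) * K S = int ((n - k) choose 2) * K S"
      using card_pairs_less[of "{1..n} - S"] by simp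
  qed
  finally have "(\<Sum>S\<in>C (Suc k). (int (Suc k * t) + int (card {e \<in> E. fst e \<in> S \<and> snd e \<notin> S})) * K S)
      = int ((n - k) choose 2) * (\<Sum>S\<in>C k. K S)"
    by (simp only: sum.distrib distrib_right sum_distrib_left)
  then have "int (\<Sum>S\<in>C (Suc k). (Suc k * t + card {e \<in> E. fst e \<in> S \<and> snd e \<notin> S})
        * card (tight E (\<lambda>_. t) S)) = int (((n - k) choose 2) * tight_sum n t k)"
    by (simp add: K_def C_def E_def tight_sum_def)
  then show ?thesis
    unfolding of_nat_eq_iff by (simp add: C_def E_def)
qed

text \<open>The number of edges leaving \<open>S\<close> lies between 0 and
  \<open>Suc k * n\<close>.\<close>

lemma tight_sum_bounds:
  "Suc k * t * tight_sum n t (Suc k) \<le> ((n - k) choose 2) * tight_sum n t k"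
  "((n - k) choose 2) * tight_sum n t k \<le> Suc k * (t + n) * tight_sum n t (Suc k)"
proof -
  have "card {e \<in> complete_edges n. fst e \<in> S \<and> snd e \<notin> S} \<le> Suc k * n"
    if "S \<subseteq> {1..n}" "card S = Suc k" for S
  proof -
    have "{e \<in> complete_edges n. fst e \<in> S \<and> snd e \<notin> S} \<subseteq> S \<times> {1..n}"
      by (auto simp: complete_edges_def)
    then have "card {e \<in> complete_edges n. fst e \<in> S \<and> snd e \<notin> S} \<le> card (S \<times> {1..n})"
      using that by (intro card_mono) (auto intro: finite_subset)
    then show ?thesis using that by (simp add: card_cartesian_product)
  qed
  then have "Suc k * t + card {e \<in> complete_edges n. fst e \<in> S \<and> snd e \<notin> S} \<le> Suc k * (t + n)"
    if "S \<subseteq> {1..n}" "card S = Suc k" for S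
    using that by (simp only: add_mult_distrib2 add_left_mono)
  then show "((n - k) choose 2) * tight_sum n t k \<le> Suc k * (t + n) * tight_sum n t (Suc k)"
    unfolding tight_sum_identity[symmetric] unfolding tight_sum_def sum_distrib_left
    by (intro sum_mono mult_right_mono) auto
  show "Suc k * t * tight_sum n t (Suc k) \<le> ((n - k) choose 2) * tight_sum n t k"
    unfolding tight_sum_identity[symmetric] unfolding tight_sum_def sum_distrib_left
    by (intro sum_mono mult_right_mono) simp_all
qed

lemma tight_sum_0: "tight_sum n t 0 = card (routings (complete_edges n) (\<lambda>_. t))"
proof -
  have "{S. S \<subseteq> {1..n} \<and> card S = 0} = {{}}"
  proof -
    have "S = {}" if "S \<subseteq> {1..n}" "card S = 0" for S
      using that finite_subset[OF that(1)] by simp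
    then show ?thesis by auto
  qed
  then show ?thesis
    by (simp only: tight_sum_def) (simp add: tight_def)
qed

text \<open>
  The last vertex has no outgoing edge besides the one to the sink, so it cannot be tight; if all
  others are tight, the edges \<open>(i, n + 1)\<close> play the role of sink edges of a smaller graph.
\<close>

lemma tight_sum_top:
  assumes "1 \<le> t"
  shows "tight_sum (Suc n) t n = card (routings (complete_edges n) (\<lambda>_. t))"
proof -
  let ?E = "complete_edges n" and ?E' = "complete_edges (Suc n)" and ?a = "\<lambda>_::nat. t"
  have E': "?E' = ?E \<union> (\<lambda>i. (i, Suc n)) ` {1..n}"
    by (auto simp: complete_edges_def)
  have gain: "netgain ?E' f u = netgain ?E f u + (if u = Suc n then \<Sum>i=1..n. f (i, Suc n) else 0)
      - (if u \<in> {1..n} then f (u, Suc n) else 0)" for f :: "edge \<Rightarrow> int" and u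
  proof -
    have "netgain ?E' f u = netgain ?E f u + netgain ((\<lambda>i. (i, Suc n)) ` {1..n}) f u"
      unfolding netgain_def E'
      using finite_complete_edges by (intro sum.union_disjoint) (auto simp: complete_edges_def)
    also have "netgain ((\<lambda>i. (i, Suc n)) ` {1..n}) f u
        = (\<Sum>i=1..n. (if Suc n = u then f (i, Suc n) else 0) - (if i = u then f (i, Suc n) else 0))"
      unfolding netgain_def by (subst sum.reindex) (auto simp: inj_on_def)
    finally show ?thesis
      by (auto simp: sum_subtractf)
  qed
  have gain0: "netgain ?E f u = 0" if "u \<notin> {1..n}" for f :: "edge \<Rightarrow> int" and u
    unfolding netgain_def by (rule sum.neutral) (use that in \<open>auto simp: complete_edges_def\<close>)
  \<comment> \<open>Vertex \<open>Suc n\<close> sends nothing along the edges of \<open>?E'\<close>,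
    so its slack is at least \<open>t > 0\<close>.\<close>
  have empty: "tight ?E' ?a S = {}" if "Suc n \<in> S" for S
  proof -
    have "0 < slack ?E' ?a f (Suc n)" if "f \<in> routings ?E' ?a" for f
    proof -
      have "0 \<le> (\<Sum>i=1..n. f (i, Suc n))"
        using routingsD(1)[OF that] by (intro sum_nonneg) blast
      then show ?thesis
        using gain0[of "Suc n" f] assms by (simp add: slack_def gain)
    qed
    then show ?thesis
      using that by (force simp: tight_def)
  qed
  have "tight_sum (Suc n) t n = (\<Sum>S\<in>{{1..n}}. card (tight ?E' ?a S))"
    unfolding tight_sum_def
  proof (rule sum.mono_neutral_right)
    show "\<forall>S\<in>{S. S \<subseteq> {1..Suc n} \<and> card S = n} - {{1..n}}. card (tight ?E' ?a S) = 0"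
    proof
      fix S assume S: "S \<in> {S. S \<subseteq> {1..Suc n} \<and> card S = n} - {{1..n}}"
      have "Suc n \<in> S"
      proof (rule ccontr)
        assume "Suc n \<notin> S"
        then have "S \<subseteq> {1..n}"
          using S by (auto simp: subset_iff le_Suc_eq)
        then show False
          using S card_subset_eq[of "{1..n}" S] by auto
      qed
      then show "card (tight ?E' ?a S) = 0"
        by (simp add: empty)
    qed
  qed auto
  also have "\<dots> = card (tight ?E' ?a {1..n})"
    by simp
  also have "\<dots> = card (routings ?E ?a)"
  proof -
    \<comment> \<open>\<open>R\<close> forgets the edges into \<open>Suc n\<close>; \<open>X\<close>
      restores them as slacks in the smaller graph, which is what tightness of
      \<open>1, ..., n\<close> demands.\<close>
    define R where "R f = (\<lambda>e. if e \<in> ?E then f e else 0)" for f :: "edge \<Rightarrow> int"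
    define X where "X g = (\<lambda>e. if e \<in> ?E then g e else if e \<in> ?E' then slack ?E ?a g (fst e) else 0)"
      for g :: "edge \<Rightarrow> int"
    have R: "slack ?E ?a (R f) u = slack ?E ?a f u" for f u
      unfolding slack_def by (simp add: R_def cong: netgain_cong)
    have X: "slack ?E ?a (X f) u = slack ?E ?a f u" for f u
      unfolding slack_def by (simp add: X_def cong: netgain_cong)
    have sl: "slack ?E' ?a f u = (if u = Suc n then int t + (\<Sum>i=1..n. f (i, Suc n))
      else if u \<in> {1..n} then slack ?E ?a f u - f (u, Suc n) else int t)" for f u
      using gain0[of u f] by (auto simp: slack_def gain)
    have XS: "X g (i, Suc n) = slack ?E ?a g i" if "i \<in> {1..n}" for g i
      using that by (auto simp: X_def complete_edges_def)
    have XR: "\<forall>f\<in>tight ?E' ?a {1..n}. X (R f) = f"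
    proof (intro ballI ext)
      fix f e assume f: "f \<in> tight ?E' ?a {1..n}"
      consider "e \<in> ?E" | i where "e = (i, Suc n)" "i \<in> {1..n}" | "e \<notin> ?E'"
        using E' by blast
      then show "X (R f) e = f e"
      proof cases
        case 2
        then show ?thesis
          using f sl[of f i] by (auto simp: XS R tight_def)
      next
        case 3
        then show ?thesis
          using f E' routingsD(2)[of f ?E' ?a e] by (simp add: X_def tight_def)
      qed (simp add: X_def R_def)
    qed
    have RX: "\<forall>g\<in>routings ?E ?a. R (X g) = g"
      by (auto simp: R_def X_def fun_eq_iff routingsD(2) simp del: split_paired_All)
    have "R f \<in> routings ?E ?a" if f: "f \<in> tight ?E' ?a {1..n}" for f
    proof -
      have "0 \<le> slack ?E ?a f u" for u
      proof (cases "u \<in> {1..n}")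
        case True
        then have "slack ?E ?a f u = f (u, Suc n)"
          using f sl[of f u] by (auto simp: tight_def)
        then show ?thesis
          using f routingsD(1)[of f ?E' ?a] by (simp add: tight_def)
      qed (simp add: slack_def gain0)
      then show ?thesis
      proof (intro routingsI)
        show "0 \<le> R f e" for e
          using f routingsD(1)[of f ?E' ?a] by (simp add: R_def tight_def)
      qed (simp_all add: R, simp add: R_def)
    qed
    then have R_into: "R ` tight ?E' ?a {1..n} \<subseteq> routings ?E ?a"
      by blast
    have "X g \<in> tight ?E' ?a {1..n}" if g: "g \<in> routings ?E ?a" for g
    proof -
      have "0 \<le> X g e" "e \<notin> ?E' \<Longrightarrow> X g e = 0" for e
        using routingsD[OF g] E' by (simp_all add: X_def)
      moreover have "slack ?E' ?a (X g) u = (if u \<in> {1..n} then 0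
          else if u = Suc n then int t + (\<Sum>i=1..n. X g (i, Suc n)) else int t)" for u
        unfolding sl X using XS[of u g] by auto
      ultimately show ?thesis
        unfolding tight_def using sum_nonneg[of "{1..n}" "\<lambda>i. X g (i, Suc n)"]
        by (auto intro!: routingsI)
    qed
    then have X_into: "X ` routings ?E ?a \<subseteq> tight ?E' ?a {1..n}"
      by blast
    from bij_betw_byWitness[OF XR RX R_into X_into] show ?thesis
      by (rule bij_betw_same_card)
  qed
  finally show ?thesis .
qed

section \<open>Asymptotics\<close>

text \<open>Start at \<open>tight_sum_top\<close> and go down \<open>r\<close> steps, squeezing
  between the two bounds. The step from \<open>Suc k\<close> to \<open>k\<close> multiplies by
  \<open>Suc k\<close>, divides by \<open>(Suc n - k) choose 2\<close> and gains one power of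
  \<open>t\<close>, since \<open>t\<close> and \<open>t + Suc n\<close> are asymptotically
  equal.\<close>

lemma tight_sum_tendsto:
  assumes "(\<lambda>t. real (card (routings (complete_edges n) (\<lambda>_. t))) / real t ^ (n choose 2)) \<longlonglongrightarrow> L"
    and "r \<le> n"
  shows "(\<lambda>t. real (tight_sum (Suc n) t (n - r)) / real t ^ ((n choose 2) + r))
    \<longlonglongrightarrow> L * (\<Prod>s=1..r. real (Suc n - s) / real (Suc s choose 2))"
  using assms(2)
proof (induction r)
  case 0
  \<comment> \<open>Equality is claimed only eventually because \<open>tight_sum_top\<close> assumes
    \<open>1 \<le> t\<close>.\<close>
  have "\<forall>\<^sub>F t in sequentially. real (card (routings (complete_edges n) (\<lambda>_. t))) / real t ^ (n choose 2)
      = real (tight_sum (Suc n) t n) / real t ^ (n choose 2)"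
    using eventually_ge_at_top[of 1] by eventually_elim (simp add: tight_sum_top)
  then show ?case
    using Lim_transform_eventually[OF assms(1)] by simp
next
  case (Suc r)
  define k where "k = n - Suc r"
  have k: "n - r = Suc k" "Suc n - k = Suc (Suc r)"
    using Suc.prems by (auto simp: k_def)
  define c where "c = real (Suc (Suc r) choose 2)"
  have c: "0 < c"
    by (simp add: c_def)
  define F where "F t = real (tight_sum (Suc n) t (Suc k)) / real t ^ ((n choose 2) + r)" for t
  define q where "q = real (Suc k) / c"
  let ?L = "L * (\<Prod>s=1..r. real (Suc n - s) / real (Suc s choose 2))"
  have F: "F \<longlonglongrightarrow> ?L"
    using Suc unfolding F_def k(1)[symmetric] by simp
  have "(\<lambda>t. real (tight_sum (Suc n) t k) / real t ^ ((n choose 2) + Suc r)) \<longlonglongrightarrow> q * ?L"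
  proof (rule tendsto_sandwich)
    show "(\<lambda>t. q * F t) \<longlonglongrightarrow> q * ?L"
      by (intro tendsto_intros F)
    have "(\<lambda>t. q * (1 + real (Suc n) * (1 / real t)) * F t) \<longlonglongrightarrow> q * (1 + real (Suc n) * 0) * ?L"
      by (intro tendsto_intros F lim_1_over_n)
    then show "(\<lambda>t. q * (1 + real (Suc n) * (1 / real t)) * F t) \<longlonglongrightarrow> q * ?L"
      by simp
    show "\<forall>\<^sub>F t in sequentially. q * F t \<le> real (tight_sum (Suc n) t k) / real t ^ ((n choose 2) + Suc r)"
      using eventually_gt_at_top[of 0]
    proof eventually_elim
      case (elim t)
      have "real (Suc k) * real t * real (tight_sum (Suc n) t (Suc k)) \<le> c * real (tight_sum (Suc n) t k)"
        using tight_sum_bounds(1)[of k t "Suc n"] unfolding k c_def by (metis of_nat_le_iff of_nat_mult)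
      moreover have eq: "q * F t = real (Suc k) * real t * real (tight_sum (Suc n) t (Suc k))
            / (c * real t ^ ((n choose 2) + Suc r))"
        using elim c by (simp add: F_def q_def)
      ultimately show ?case
        unfolding eq using elim c by (simp add: divide_simps mult_ac)
    qed
    show "\<forall>\<^sub>F t in sequentially. real (tight_sum (Suc n) t k) / real t ^ ((n choose 2) + Suc r)
        \<le> q * (1 + real (Suc n) * (1 / real t)) * F t"
      using eventually_gt_at_top[of 0]
    proof eventually_elim
      case (elim t)
      have "c * real (tight_sum (Suc n) t k)
          \<le> real (Suc k) * (real t + real (Suc n)) * real (tight_sum (Suc n) t (Suc k))"
        using tight_sum_bounds(2)[of "Suc n" k t] unfolding k c_def
        by (metis of_nat_le_iff of_nat_mult of_nat_add)
      moreover have eq: "q * (1 + real (Suc n) * (1 / real t)) * F t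
          = real (Suc k) * (real t + real (Suc n)) * real (tight_sum (Suc n) t (Suc k))
            / (c * real t ^ ((n choose 2) + Suc r))"
        using elim c by (simp add: F_def q_def divide_simps)
      ultimately show ?case
        unfolding eq using elim c by (simp add: divide_simps mult_ac)
    qed
  qed
  moreover have "q * ?L = L * (\<Prod>s=1..Suc r. real (Suc n - s) / real (Suc s choose 2))"
    by (simp add: q_def c_def k(1)[symmetric])
  ultimately show ?case
    by (simp add: k_def)
qed

lemma prod_choose_2: "(\<Prod>s=1..n. real (Suc s choose 2)) = fact n * fact (Suc n) / 2 ^ n"
proof (induction n)
  case (Suc n)
  have "real (Suc (Suc n) choose 2) = real (Suc n) * real (Suc (Suc n)) / 2"
    by (simp add: choose_two field_simps real_of_nat_div)
  then show ?case
    using Suc by (simp add: field_simps)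
qed simp

text \<open>All \<open>n\<close> steps of the chain lead from the complete graph on
  \<open>n + 1\<close> vertices to that on \<open>n + 2\<close>, with factor
  \<open>n! * 2^n / (n! * (n + 1)!) = 2^n / (n + 1)!\<close>.\<close>

lemma card_routings_complete_tendsto:
  "(\<lambda>t. real (card (routings (complete_edges n) (\<lambda>_. t))) / real t ^ (n choose 2))
    \<longlonglongrightarrow> 2 ^ (n choose 2) / (\<Prod>i=1..n. fact i)"
proof (induction n)
  case 0
  have "complete_edges 0 = {}"
    by (auto simp: complete_edges_def)
  then show ?case
    by (simp add: routings_empty numeral_2_eq_2)
next
  case (Suc n)
  have N: "Suc n choose 2 = (n choose 2) + n"
    by (simp add: numeral_2_eq_2)
  have "(\<Prod>s=1..n. real (Suc n - s)) = fact n"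
    unfolding fact_prod of_nat_prod
    by (rule prod.reindex_bij_witness[of _ "\<lambda>i. Suc n - i" "\<lambda>i. Suc n - i"]) auto
  then have "(\<Prod>s=1..n. real (Suc n - s) / real (Suc s choose 2)) = 2 ^ n / fact (Suc n)"
    by (simp only: prod_dividef prod_choose_2) simp
  then show ?case
    using tight_sum_tendsto[OF Suc.IH, of n]
    by (simp add: tight_sum_0 N power_add mult.commute del: fact_Suc)
qed

text \<open>The degree need not be known beforehand: were \<open>d\<close> larger, the limit would
  be 0; were the degree larger, the leading coefficient would be 0.\<close>

lemma lead_coeff_eq_limit:
  assumes "(\<lambda>t. poly p (real t) / real t ^ d) \<longlonglongrightarrow> c" "c \<noteq> 0"
  shows "lead_coeff p = c"
proof -
  have "((\<lambda>x. poly p x / x ^ degree p) \<longlongrightarrow> lead_coeff p) at_infinity"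
    by (rule poly_divide_tendsto_aux)
  then have lc: "(\<lambda>t. poly p (real t) / real t ^ degree p) \<longlonglongrightarrow> lead_coeff p"
    by (rule filterlim_compose[OF _ tendsto_of_nat])
  have small: "(\<lambda>t. g t * (1 / real t) ^ k) \<longlonglongrightarrow> 0" if "g \<longlonglongrightarrow> l" "0 < k" for g k and l :: real
    using tendsto_mult[OF that(1) tendsto_power[OF lim_1_over_n, of k]] that(2) by (simp add: power_0_left)
  have eq: "x / real t ^ j * (1 / real t) ^ k = x / real t ^ (j + k)" for x :: real and t j k
    by (simp add: power_add power_one_over)
  consider "degree p = d" | k where "d = degree p + k" "0 < k" | k where "degree p = d + k" "0 < k"
    by (metis less_imp_add_positive linorder_neqE_nat)
  then show ?thesis
  proof cases
    case 1
    then show ?thesis using lc assms(1) LIMSEQ_unique by blast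
  next
    case 2
    then show ?thesis using small[OF lc 2(2)] assms LIMSEQ_unique unfolding eq by metis
  next
    case 3
    then have "lead_coeff p = 0"
      using small[OF assms(1) 3(2)] lc LIMSEQ_unique unfolding eq by metis
    then have "p = 0"
      by (simp only: leading_coeff_0_iff)
    then show ?thesis using 3 by simp
  qed
qed

lemma choose_tendsto: "(\<lambda>t. real ((t + k) choose k) / real t ^ k) \<longlonglongrightarrow> 1 / fact k"
proof (induction k)
  case (Suc k)
  have "(\<lambda>t. real ((t + k) choose k) / real t ^ k * ((1 + real (Suc k) * (1 / real t)) / real (Suc k)))
      \<longlonglongrightarrow> 1 / fact k * ((1 + real (Suc k) * 0) / real (Suc k))"
    by (intro tendsto_intros Suc lim_1_over_n) simp
  moreover have "\<forall>\<^sub>F t in sequentially. real ((t + k) choose k) / real t ^ k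
      * ((1 + real (Suc k) * (1 / real t)) / real (Suc k)) = real ((t + Suc k) choose Suc k) / real t ^ Suc k"
    using eventually_gt_at_top[of 0]
  proof eventually_elim
    case (elim t)
    have "real (Suc (t + k)) * real ((t + k) choose k) = real (Suc (t + k) choose Suc k) * real (Suc k)"
      unfolding of_nat_mult[symmetric] by (simp only: Suc_times_binomial_eq)
    then have eq: "real ((t + Suc k) choose Suc k) = real (Suc (t + k)) * real ((t + k) choose k) / real (Suc k)"
      by (simp add: field_simps del: binomial_Suc_Suc)
    show ?case
      unfolding eq using elim by (simp add: field_simps)
  qed
  ultimately show ?case
    using Lim_transform_eventually by (force simp: field_simps)
qed simp

section \<open>From flow polytopes to integer flows\<close>

lemma lookup_scaleR:
  "Poly_Mapping.lookup (r *\<^sub>R x) e = r *\<^sub>R Poly_Mapping.lookup (x :: ('a, 'b::real_vector) poly_mapping) e"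
proof -
  have "finite {e. r *\<^sub>R Poly_Mapping.lookup x e \<noteq> 0}"
    by (rule finite_subset[OF _ finite_lookup[of x]]) auto
  then show ?thesis
    by (simp add: scaleR_poly_mapping_def)
qed

lemma netgain_eq:
  assumes "finite E"
  shows "netgain E f i = (\<Sum>g | (g, i) \<in> E. f (g, i)) - (\<Sum>j | (i, j) \<in> E. f (i, j))"
proof -
  have "(\<Sum>e\<in>E. if snd e = i then f e else 0) = (\<Sum>g | (g, i) \<in> E. f (g, i))"
    unfolding sum.inter_filter[OF assms, symmetric]
    by (rule sum.reindex_bij_witness[of _ "\<lambda>g. (g, i)" fst]) auto
  moreover have "(\<Sum>e\<in>E. if fst e = i then f e else 0) = (\<Sum>j | (i, j) \<in> E. f (i, j))"
    unfolding sum.inter_filter[OF assms, symmetric]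
    by (rule sum.reindex_bij_witness[of _ "\<lambda>j. (i, j)" snd]) auto
  ultimately show ?thesis
    by (simp add: netgain_def sum_subtractf)
qed

lemma netgain_lookup_add:
  "netgain E (Poly_Mapping.lookup (x + y)) u
    = netgain E (Poly_Mapping.lookup x) u + netgain E (Poly_Mapping.lookup y) u"
  unfolding netgain_def sum.distrib[symmetric] by (rule sum.cong) (auto simp: lookup_add)

lemma netgain_lookup_diff:
  "netgain E (Poly_Mapping.lookup (x - y)) u
    = netgain E (Poly_Mapping.lookup x) u - netgain E (Poly_Mapping.lookup y) u"
  unfolding netgain_def sum_subtractf[symmetric] by (rule sum.cong) (auto simp: lookup_minus)

lemma netgain_lookup_scaleR:
  "netgain E (Poly_Mapping.lookup (r *\<^sub>R x)) u = r * netgain E (Poly_Mapping.lookup x) u"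
  for x :: "(edge, real) poly_mapping"
  unfolding netgain_def sum_distrib_left
  by (rule sum.cong) (auto simp: lookup_scaleR algebra_simps)

lemma netgain_of_int: "netgain E (\<lambda>e. of_int (f e)) u = (of_int (netgain E f u) :: 'a::ring_1)"
  unfolding netgain_def of_int_sum by (rule sum.cong) auto

section \<open>Graphs with a sink edge at every other vertex\<close>

text \<open>Both graphs of the theorem have this shape: \<open>E\<close> holds the edges among the
  non-sink vertices and \<open>G\<close> adds every sink edge, so one treatment serves both.\<close>

locale inner_graph =
  fixes m :: nat and E :: "edge set"
  assumes finite_E: "finite E"
    and inner: "e \<in> E \<Longrightarrow> 1 \<le> fst e \<and> fst e < snd e \<and> snd e \<le> m"
begin

definition G :: "edge set" where
  "G = E \<union> (\<lambda>i. (i, m + 1)) ` {1..m}"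

lemma G_cases:
  obtains "e \<in> E" | i where "e = (i, Suc m)" "i \<in> {1..m}" | "e \<notin> G"
  unfolding G_def by (metis UnE imageE Suc_eq_plus1)

lemma finite_G: "finite G"
  using finite_E by (simp add: G_def)

lemma not_E: "(i, Suc m) \<notin> E"
  using inner[of "(i, Suc m)"] by auto

text \<open>Conservation at \<open>i \<le> m\<close> just fixes the flow on the sink edge of
  \<open>i\<close>. Conservation at the sink follows by adding up, since the net gains through
  \<open>E\<close> cancel.\<close>

lemma is_flow_iff:
  "is_flow m G a x \<longleftrightarrow> Poly_Mapping.keys x \<subseteq> G \<and> (\<forall>e\<in>G. 0 \<le> Poly_Mapping.lookup x e) \<and>
    (\<forall>i\<in>{1..m}. Poly_Mapping.lookup x (i, Suc m) = of_int (a i) + netgain E (Poly_Mapping.lookup x) i)"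
proof -
  let ?x = "Poly_Mapping.lookup x"
  have mid: "(\<Sum>g | (g, i) \<in> G. ?x (g, i)) + of_int (netflow m a i) = (\<Sum>j | (i, j) \<in> G. ?x (i, j))
      \<longleftrightarrow> ?x (i, Suc m) = of_int (a i) + netgain E ?x i" if i: "i \<in> {1..m}" for i
  proof -
    have "{g. (g, i) \<in> G} = {g. (g, i) \<in> E}" "{j. (i, j) \<in> G} = insert (Suc m) {j. (i, j) \<in> E}"
      using i by (auto simp: G_def)
    moreover have "finite {j. (i, j) \<in> E}"
      by (rule finite_subset[OF _ finite_imageI[OF finite_E, of snd]]) force
    ultimately show ?thesis
      using i not_E by (auto simp: netgain_eq[OF finite_E] netflow_def)
  qed
  have last: "(\<Sum>g | (g, Suc m) \<in> G. ?x (g, Suc m)) + of_int (netflow m a (Suc m))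
      = (\<Sum>j | (Suc m, j) \<in> G. ?x (Suc m, j))"
    if *: "\<forall>i\<in>{1..m}. ?x (i, Suc m) = of_int (a i) + netgain E ?x i"
  proof -
    have "{g. (g, Suc m) \<in> G} = {1..m}"
      using not_E by (auto simp: G_def)
    moreover have "{j. (Suc m, j) \<in> G} = {}"
      using inner by (fastforce simp: G_def)
    moreover have "(\<Sum>i=1..m. netgain E ?x i) = 0"
      unfolding sum_netgain[OF finite_atLeastAtMost]
      using inner by (intro sum.neutral) force
    ultimately show ?thesis
      using * by (simp add: netflow_def sum.distrib)
  qed
  have "{1..m + 1} = insert (Suc m) {1..m}"
    by auto
  then show ?thesis
    unfolding is_flow_def using mid last by auto
qed

lemma scaled_flow_polytope:
  assumes "1 \<le> t"
  shows "(\<lambda>x. real t *\<^sub>R x) ` flow_polytope m G (\<lambda>_. 1) = flow_polytope m G (\<lambda>_. int t)"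
proof (intro equalityI subsetI)
  have keys: "Poly_Mapping.keys (r *\<^sub>R x) \<subseteq> Poly_Mapping.keys x" for r and x :: "(edge, real) poly_mapping"
    by (auto simp: in_keys_iff lookup_scaleR)
  fix x
  {
    assume "x \<in> (\<lambda>x. real t *\<^sub>R x) ` flow_polytope m G (\<lambda>_. 1)"
    then obtain y where "x = real t *\<^sub>R y" "is_flow m G (\<lambda>_. 1) y"
      by (auto simp: flow_polytope_def)
    then show "x \<in> flow_polytope m G (\<lambda>_. int t)"
      using keys[of "real t" y]
      by (auto simp: flow_polytope_def is_flow_iff lookup_scaleR netgain_lookup_scaleR distrib_left)
  }
  {
    assume "x \<in> flow_polytope m G (\<lambda>_. int t)"
    then have "(1 / real t) *\<^sub>R x \<in> flow_polytope m G (\<lambda>_. 1)"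
      using keys[of "1 / real t" x] assms
      by (auto simp: flow_polytope_def is_flow_iff lookup_scaleR netgain_lookup_scaleR
          add_divide_distrib)
    moreover have "x = real t *\<^sub>R ((1 / real t) *\<^sub>R x)"
      using assms by simp
    ultimately show "x \<in> (\<lambda>x. real t *\<^sub>R x) ` flow_polytope m G (\<lambda>_. 1)"
      by blast
  }
qed

text \<open>Parametrizes flows by their values on \<open>E\<close>, with sink edges filled in by
  conservation. The constant \<open>c\<close> is the netflow: \<open>t\<close> for dilated lattice
  points, \<open>1\<close> for the polytope, \<open>0\<close> for circulations.\<close>

definition extend :: "real \<Rightarrow> (edge \<Rightarrow> real) \<Rightarrow> (edge, real) poly_mapping" where
  "extend c f = Abs_poly_mapping
    (\<lambda>e. if e \<in> E then f e else if e \<in> G then c + netgain E f (fst e) else 0)"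

lemma lookup_extend:
  "Poly_Mapping.lookup (extend c f) e
    = (if e \<in> E then f e else if e \<in> G then c + netgain E f (fst e) else 0)"
proof -
  have "finite {e. (if e \<in> E then f e else if e \<in> G then c + netgain E f (fst e) else 0) \<noteq> 0}"
    by (rule finite_subset[OF _ finite_G]) (auto simp: G_def)
  then show ?thesis
    by (simp add: extend_def)
qed

lemma netgain_extend: "netgain E (Poly_Mapping.lookup (extend c f)) u = netgain E f u"
  by (simp add: lookup_extend cong: netgain_cong)

lemma extend_sink:
  assumes "i \<in> {1..m}"
  shows "Poly_Mapping.lookup (extend c f) (i, Suc m) = c + netgain E f i"
  using assms not_E by (simp add: lookup_extend G_def)

lemma keys_extend: "Poly_Mapping.keys (extend c f) \<subseteq> G"
  by (auto simp: in_keys_iff lookup_extend G_def split: if_splits)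

lemma is_flow_extend:
  assumes "\<And>e. e \<in> E \<Longrightarrow> 0 \<le> f e" "\<And>i. i \<in> {1..m} \<Longrightarrow> 0 \<le> of_int c + netgain E f i"
  shows "is_flow m G (\<lambda>_. c) (extend (of_int c) f)"
  unfolding is_flow_iff using assms keys_extend
  by (auto simp: netgain_extend extend_sink lookup_extend G_def not_E)

text \<open>Restriction to \<open>E\<close> is a bijection: the sink values are determined by
  conservation and are automatically integral.\<close>

lemma lattice_point_count_eq:
  assumes "1 \<le> t"
  shows "lattice_point_count ((\<lambda>x. real t *\<^sub>R x) ` flow_polytope m G (\<lambda>_. 1))
    = card (routings E (\<lambda>_. t))"
proof -
  let ?L = "{x \<in> flow_polytope m G (\<lambda>_. int t). \<forall>e. Poly_Mapping.lookup x e \<in> \<int>}"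
  \<comment> \<open>On lattice points the floor is only a conversion of integral reals to
    integers.\<close>
  define \<rho> where "\<rho> x = (\<lambda>e. if e \<in> E then \<lfloor>Poly_Mapping.lookup x e\<rfloor> else 0)"
    for x :: "(edge, real) poly_mapping"
  define X where "X f = extend (real t) (\<lambda>e. of_int (f e))" for f :: "edge \<Rightarrow> int"
  have slack: "of_int (slack E (\<lambda>_. t) f u) = real t + netgain E (\<lambda>e. of_int (f e)) u" for f u
    by (simp add: slack_def netgain_of_int)
  have gain0: "netgain E (f :: edge \<Rightarrow> int) u = 0" if "u \<notin> {1..m}" for f u
    unfolding netgain_def by (rule sum.neutral) (use that inner in fastforce)
  have floor: "of_int \<lfloor>Poly_Mapping.lookup x e\<rfloor> = Poly_Mapping.lookup x e" if "x \<in> ?L" for x e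
  proof -
    have "Poly_Mapping.lookup x e \<in> \<int>"
      using that by blast
    then show ?thesis by simp
  qed
  have XR: "\<forall>x\<in>?L. X (\<rho> x) = x"
  proof
    fix x assume x: "x \<in> ?L"
    have gain: "netgain E (\<lambda>e. of_int (\<rho> x e)) u = netgain E (Poly_Mapping.lookup x) u" for u
      using floor[OF x] by (intro netgain_cong) (simp add: \<rho>_def)
    show "X (\<rho> x) = x"
    proof (rule poly_mapping_eqI)
      fix e
      consider "e \<in> E" | i where "e = (i, Suc m)" "i \<in> {1..m}" | "e \<notin> G"
        by (rule G_cases)
      then show "Poly_Mapping.lookup (X (\<rho> x)) e = Poly_Mapping.lookup x e"
      proof cases
        case 1
        then show ?thesis
          using floor[OF x] by (simp add: X_def lookup_extend \<rho>_def)
      next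
        case 2
        then show ?thesis
          using x by (simp add: X_def extend_sink gain flow_polytope_def is_flow_iff)
      next
        case 3
        then have "Poly_Mapping.lookup x e = 0"
          using x by (auto simp: flow_polytope_def is_flow_iff in_keys_iff)
        then show ?thesis
          using 3 by (simp add: X_def lookup_extend G_def)
      qed
    qed
  qed
  have RX: "\<forall>f\<in>routings E (\<lambda>_. t). \<rho> (X f) = f"
    by (auto simp: \<rho>_def X_def lookup_extend fun_eq_iff routingsD(2) simp del: split_paired_All)
  have "\<rho> x \<in> routings E (\<lambda>_. t)" if x: "x \<in> ?L" for x
  proof (rule routingsI)
    have flow: "is_flow m G (\<lambda>_. int t) x"
      using x by (simp add: flow_polytope_def)
    show "0 \<le> \<rho> x e" for e
      using flow unfolding is_flow_iff by (auto simp: \<rho>_def G_def)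
    show "0 \<le> slack E (\<lambda>_. t) (\<rho> x) u" for u
    proof (cases "u \<in> {1..m}")
      case True
      have "netgain E (\<lambda>e. of_int (\<rho> x e)) u = netgain E (Poly_Mapping.lookup x) u"
        using floor[OF x] by (intro netgain_cong) (simp add: \<rho>_def)
      then have "of_int (slack E (\<lambda>_. t) (\<rho> x) u) = Poly_Mapping.lookup x (u, Suc m)"
        using flow True by (simp add: slack is_flow_iff)
      moreover have "(u, Suc m) \<in> G"
        using True by (simp add: G_def)
      ultimately show ?thesis
        using flow by (metis is_flow_iff of_int_0_le_iff)
    qed (simp add: slack_def gain0)
  qed (simp add: \<rho>_def)
  then have R_into: "\<rho> ` ?L \<subseteq> routings E (\<lambda>_. t)"
    by blast
  have "X f \<in> ?L" if f: "f \<in> routings E (\<lambda>_. t)" for f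
  proof -
    have "is_flow m G (\<lambda>_. int t) (extend (of_int (int t)) (\<lambda>e. of_int (f e)))"
    proof (rule is_flow_extend)
      show "0 \<le> of_int (int t) + netgain E (\<lambda>e. real_of_int (f e)) i" for i
        using routingsD(3)[OF f, of i] slack[of f i] by (metis of_int_0_le_iff of_int_of_nat_eq)
    qed (use routingsD(1)[OF f] in simp)
    moreover have "Poly_Mapping.lookup (X f) e \<in> \<int>" for e
      by (auto simp: X_def lookup_extend netgain_of_int)
    ultimately show ?thesis
      by (simp add: X_def flow_polytope_def)
  qed
  then have X_into: "X ` routings E (\<lambda>_. t) \<subseteq> ?L"
    by blast
  from bij_betw_byWitness[OF XR RX R_into X_into] show ?thesis
    unfolding lattice_point_count_def scaled_flow_polytope[OF assms] by (rule bij_betw_same_card)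
qed

section \<open>Dimension of the polytope\<close>

text \<open>Solutions with netflow 0 and no sign condition: the direction space of the affine
  hull.\<close>

definition circulations :: "(edge, real) poly_mapping set" where
  "circulations = {x. Poly_Mapping.keys x \<subseteq> G \<and>
    (\<forall>i\<in>{1..m}. Poly_Mapping.lookup x (i, Suc m) = netgain E (Poly_Mapping.lookup x) i)}"

lemma keys_subset_iff: "Poly_Mapping.keys x \<subseteq> G \<longleftrightarrow> (\<forall>e. e \<notin> G \<longrightarrow> Poly_Mapping.lookup x e = 0)"
  by (auto simp: in_keys_iff)

lemma subspace_circulations: "subspace circulations"
proof -
  have "netgain E (Poly_Mapping.lookup (0 :: (edge, real) poly_mapping)) i = 0" for i
    by (simp add: netgain_def cong: if_cong)
  then show ?thesis
    by (auto simp: subspace_def circulations_def keys_subset_iff lookup_add lookup_scaleR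
        netgain_lookup_add netgain_lookup_scaleR simp del: split_paired_All)
qed

lemma circulation_eqI:
  assumes "x \<in> circulations" "y \<in> circulations"
    and eq: "\<And>e. e \<in> E \<Longrightarrow> Poly_Mapping.lookup x e = Poly_Mapping.lookup y e"
  shows "x = y"
proof (rule poly_mapping_eqI)
  fix e
  have gain: "netgain E (Poly_Mapping.lookup x) u = netgain E (Poly_Mapping.lookup y) u" for u
    using eq by (rule netgain_cong)
  consider "e \<in> E" | i where "e = (i, Suc m)" "i \<in> {1..m}" | "e \<notin> G"
    by (rule G_cases)
  then show "Poly_Mapping.lookup x e = Poly_Mapping.lookup y e"
  proof cases
    case 1
    then show ?thesis by (rule eq)
  next
    case 2
    then show ?thesis
      using assms(1,2) gain by (simp add: circulations_def)
  next
    case 3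
    then show ?thesis
      using assms(1,2) by (simp add: circulations_def keys_subset_iff del: split_paired_All)
  qed
qed

lemma extend_circulation: "extend 0 f \<in> circulations"
  using keys_extend by (auto simp: circulations_def netgain_extend extend_sink)

text \<open>The values on \<open>E\<close> are free and determine the rest. The basis vector
  \<open>b e\<close> is one unit on \<open>e\<close>, balanced by \<open>-1\<close> and
  \<open>1\<close> on the sink edges of its tail and head.\<close>

lemma dim_circulations: "dim circulations = card E"
proof -
  define b where "b e = extend 0 (\<lambda>e'. if e' = e then 1 else 0)" for e
  have b: "Poly_Mapping.lookup (b e) e' = (if e' = e then 1 else 0)" if "e' \<in> E" for e e'
    using that by (simp add: b_def lookup_extend)
  have inj: "inj_on b E"
    by (rule inj_onI) (metis b zero_neq_one)
  have lin: "Poly_Mapping.lookup (\<Sum>e\<in>E. c e *\<^sub>R b e) e' = c e'" if "e' \<in> E" for c e'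
    using that finite_E by (simp add: lookup_sum lookup_scaleR b if_distrib cong: if_cong)
  show ?thesis
  proof (rule dim_unique)
    show "b ` E \<subseteq> circulations"
      by (auto simp: b_def extend_circulation)
    show "circulations \<subseteq> span (b ` E)"
    proof
      fix x assume x: "x \<in> circulations"
      have "(\<Sum>e\<in>E. Poly_Mapping.lookup x e *\<^sub>R b e) \<in> circulations"
        by (intro subspace_sum[OF subspace_circulations] subspace_scale[OF subspace_circulations])
          (simp add: b_def extend_circulation)
      then have "x = (\<Sum>e\<in>E. Poly_Mapping.lookup x e *\<^sub>R b e)"
        using x lin by (intro circulation_eqI) auto
      moreover have "(\<Sum>e\<in>E. Poly_Mapping.lookup x e *\<^sub>R b e) \<in> span (b ` E)"
        by (intro span_sum span_scale span_base) auto
      ultimately show "x \<in> span (b ` E)"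
        by simp
    qed
    show "independent (b ` E)"
    proof
      assume "dependent (b ` E)"
      then obtain c e where c: "e \<in> E" "c (b e) \<noteq> 0" "(\<Sum>v\<in>b ` E. c v *\<^sub>R v) = 0"
        using dependent_finite[of "b ` E"] finite_E by auto
      have "(\<Sum>e\<in>E. c (b e) *\<^sub>R b e) = 0"
        using c(3) by (simp add: sum.reindex[OF inj])
      then show False
        using lin[OF c(1), of "\<lambda>e. c (b e)"] c(2) by simp
    qed
    show "card (b ` E) = card E"
      by (rule card_image[OF inj])
  qed
qed

lemma interior_flow:
  "\<exists>x \<delta>. is_flow m G (\<lambda>_. 1) x \<and> 0 < \<delta> \<and> (\<forall>e\<in>G. \<delta> \<le> Poly_Mapping.lookup x e)"
proof -
  \<comment> \<open>With \<open>\<delta>\<close> on each inner edge a vertex loses at most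
    \<open>card E * \<delta>\<close>; this choice leaves at least \<open>\<delta>\<close> of the
    unit supply for its sink edge.\<close>
  define \<delta> where "\<delta> = 1 / (real (card E) + 1)"
  have \<delta>: "0 < \<delta>" "\<delta> + real (card E) * \<delta> = 1"
    by (simp_all add: \<delta>_def field_simps)
  have gain: "\<delta> \<le> 1 + netgain E (\<lambda>_. \<delta>) i" for i
  proof -
    have "(\<Sum>e\<in>E. - \<delta>) \<le> netgain E (\<lambda>_. \<delta>) i"
      unfolding netgain_def using \<delta>(1) by (intro sum_mono) auto
    then show ?thesis using \<delta>(2) by simp
  qed
  have "is_flow m G (\<lambda>_. 1) (extend (of_int 1) (\<lambda>_. \<delta>))"
    using gain \<delta>(1) by (intro is_flow_extend) (auto intro: order_trans[OF less_imp_le])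
  moreover have "\<forall>e\<in>G. \<delta> \<le> Poly_Mapping.lookup (extend (of_int 1) (\<lambda>_. \<delta>)) e"
    using gain by (auto simp: lookup_extend)
  ultimately show ?thesis
    using \<delta>(1) by blast
qed

text \<open>The equations confine the direction space to the circulations. Conversely, a flow
  positive on all edges can move a little along any circulation without violating a sign
  condition.\<close>

lemma polytope_dim_flow_polytope: "polytope_dim (flow_polytope m G (\<lambda>_. 1)) = card E"
proof -
  let ?P = "flow_polytope m G (\<lambda>_. 1)"
  define A :: "(edge, real) poly_mapping set" where "A = {x. Poly_Mapping.keys x \<subseteq> G \<and>
    (\<forall>i\<in>{1..m}. Poly_Mapping.lookup x (i, Suc m) = 1 + netgain E (Poly_Mapping.lookup x) i)}"
  have "affine A"
    unfolding affine_def
  proof (intro ballI allI impI)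
    fix x y and u v :: real
    assume x: "x \<in> A" and y: "y \<in> A" and uv: "u + v = 1"
    have "u * (1 + p) + v * (1 + q) = 1 + (u * p + v * q)" for p q :: real
      using uv by (simp add: algebra_simps)
    then show "u *\<^sub>R x + v *\<^sub>R y \<in> A"
      using x y by (auto simp: A_def keys_subset_iff lookup_add lookup_scaleR netgain_lookup_add netgain_lookup_scaleR
          simp del: split_paired_All)
  qed
  moreover have "?P \<subseteq> A"
    by (auto simp: flow_polytope_def is_flow_iff A_def)
  ultimately have hull: "affine hull ?P \<subseteq> A"
    by (intro hull_minimal)
  have "{x - y | x y. x \<in> affine hull ?P \<and> y \<in> affine hull ?P} = circulations"
  proof (intro equalityI subsetI)
    fix z assume "z \<in> {x - y | x y. x \<in> affine hull ?P \<and> y \<in> affine hull ?P}"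
    then obtain x y where z: "z = x - y" and xy: "x \<in> A" "y \<in> A"
      using hull by auto
    show "z \<in> circulations"
      using xy by (auto simp: A_def z circulations_def keys_subset_iff lookup_minus netgain_lookup_diff
          simp del: split_paired_All)
  next
    fix z assume z: "z \<in> circulations"
    obtain x \<delta> where x: "is_flow m G (\<lambda>_. 1) x" "0 < \<delta>" "\<And>e. e \<in> G \<Longrightarrow> \<delta> \<le> Poly_Mapping.lookup x e"
      using interior_flow by blast
    \<comment> \<open>\<open>s\<close> bounds every entry of \<open>z\<close>, and the summand 1
      keeps it positive when \<open>z\<close> vanishes; a step \<open>\<epsilon>\<close> thus
      changes each edge by at most \<open>\<delta>\<close>.\<close>
    define s where "s = 1 + (\<Sum>e\<in>G. \<bar>Poly_Mapping.lookup z e\<bar>)"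
    define \<epsilon> where "\<epsilon> = \<delta> / s"
    have s: "0 < s"
      unfolding s_def by (intro add_pos_nonneg sum_nonneg) auto
    then have \<epsilon>: "0 < \<epsilon>"
      using x(2) by (simp add: \<epsilon>_def)
    have "is_flow m G (\<lambda>_. 1) (x + \<epsilon> *\<^sub>R z)"
      unfolding is_flow_iff
    proof (intro conjI ballI)
      show "Poly_Mapping.keys (x + \<epsilon> *\<^sub>R z) \<subseteq> G"
        using x(1) z by (auto simp: is_flow_iff circulations_def keys_subset_iff lookup_add lookup_scaleR
            simp del: split_paired_All)
    next
      fix e assume e: "e \<in> G"
      have "\<bar>Poly_Mapping.lookup z e\<bar> \<le> s"
        unfolding s_def using member_le_sum[OF e, of "\<lambda>e. \<bar>Poly_Mapping.lookup z e\<bar>"] finite_G by simp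
      then have "\<epsilon> * \<bar>Poly_Mapping.lookup z e\<bar> \<le> \<epsilon> * s"
        using \<epsilon> by (intro mult_left_mono) auto
      then have "\<bar>\<epsilon> * Poly_Mapping.lookup z e\<bar> \<le> \<delta>"
        using s \<epsilon> x(2) by (simp add: \<epsilon>_def abs_mult)
      then show "0 \<le> Poly_Mapping.lookup (x + \<epsilon> *\<^sub>R z) e"
        using x(3)[OF e] by (simp add: lookup_add lookup_scaleR)
    next
      fix i assume "i \<in> {1..m}"
      then show "Poly_Mapping.lookup (x + \<epsilon> *\<^sub>R z) (i, Suc m)
          = of_int 1 + netgain E (Poly_Mapping.lookup (x + \<epsilon> *\<^sub>R z)) i"
        using x(1) z by (simp add: is_flow_iff circulations_def lookup_add lookup_scaleR netgain_lookup_add netgain_lookup_scaleR)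
    qed
    then have "x \<in> affine hull ?P" "x + \<epsilon> *\<^sub>R z \<in> affine hull ?P"
      using x(1) by (auto simp: flow_polytope_def intro: hull_inc)
    \<comment> \<open>Extrapolate the line from \<open>x\<close> through
      \<open>x + \<epsilon> *\<^sub>R z\<close> as far as \<open>x + z\<close>.\<close>
    then have "(1 - 1 / \<epsilon>) *\<^sub>R x + (1 / \<epsilon>) *\<^sub>R (x + \<epsilon> *\<^sub>R z) \<in> affine hull ?P"
      by (intro mem_affine) auto
    moreover have "(1 - 1 / \<epsilon>) *\<^sub>R x + (1 / \<epsilon>) *\<^sub>R (x + \<epsilon> *\<^sub>R z) = x + z"
      using \<epsilon> by (simp add: algebra_simps)
    ultimately have "z = (x + z) - x" "x + z \<in> affine hull ?P"
      by simp_all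
    then show "z \<in> {x - y | x y. x \<in> affine hull ?P \<and> y \<in> affine hull ?P}"
      using \<open>x \<in> affine hull ?P\<close> by blast
  qed
  then show ?thesis
    by (simp add: polytope_dim_def dim_circulations)
qed

text \<open>The definite description in \<open>ehrhart_poly\<close> denotes because the count is
  polynomial in \<open>t\<close> and polynomials agreeing at all \<open>t \<ge> 1\<close> coincide.
  The limit then yields the leading coefficient.\<close>

lemma normalized_volume_flow_polytope:
  assumes "(\<lambda>t. real (card (routings E (\<lambda>_. t))) / real t ^ d) \<longlonglongrightarrow> c" "c \<noteq> 0"
  shows "normalized_volume (flow_polytope m G (\<lambda>_. 1)) = fact (card E) * c"
proof -
  have "fst e < snd e" if "e \<in> E" for e
    using inner[OF that] by simp
  then have "(\<lambda>a. real (card (routings E a))) \<in> poly_funs"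
    using card_routings_poly_funs[OF finite_E] by blast
  then obtain p where p: "\<And>t. real (card (routings E (\<lambda>_. t))) = poly p (real t)"
    using poly_funs_diagonal by blast
  have "ehrhart_poly (flow_polytope m G (\<lambda>_. 1)) = p"
    unfolding ehrhart_poly_def
  proof (rule the_equality)
    show "\<forall>t\<ge>1. poly p (real t)
        = real (lattice_point_count ((\<lambda>x. real t *\<^sub>R x) ` flow_polytope m G (\<lambda>_. 1)))"
      by (simp add: lattice_point_count_eq p)
  next
    fix q assume q: "\<forall>t\<ge>1. poly q (real t)
        = real (lattice_point_count ((\<lambda>x. real t *\<^sub>R x) ` flow_polytope m G (\<lambda>_. 1)))"
    have "real ` {1..} \<subseteq> {x. poly (q - p) x = 0}"
      using q by (auto simp: lattice_point_count_eq p)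
    moreover have "infinite (real ` {1..})"
      by (simp add: finite_image_iff infinite_Ici)
    ultimately have "q - p = 0"
      using poly_roots_finite finite_subset by blast
    then show "q = p" by simp
  qed
  moreover have "lead_coeff p = c"
    using assms by (intro lead_coeff_eq_limit[of p d]) (simp_all add: p)
  ultimately show ?thesis
    by (simp add: normalized_volume_def polytope_dim_flow_polytope)
qed

end

section \<open>Volumes of the two polytopes\<close>

lemma normalized_volume_complete:
  "normalized_volume (flow_polytope n (complete_edges (n + 1)) (\<lambda>_. 1))
    = fact (n choose 2) * (2 ^ (n choose 2) / (\<Prod>i=1..n. fact i))"
proof -
  interpret inner_graph n "complete_edges n"
    using finite_complete_edges by unfold_locales (auto simp: complete_edges_def)
  have "complete_edges (n + 1) = G"
    unfolding G_def by (auto simp: complete_edges_def)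
  moreover have "card (complete_edges n) = n choose 2"
  proof -
    have "complete_edges n = {(i, j). i \<in> {1..n} \<and> j \<in> {1..n} \<and> i < j}"
      by (auto simp: complete_edges_def)
    then show ?thesis
      using card_pairs_less[of "{1..n}"] by simp
  qed
  ultimately show ?thesis
    using normalized_volume_flow_polytope[OF card_routings_complete_tendsto] by simp
qed

text \<open>The inner edges lead from \<open>1, ..., n - 1\<close> to
  \<open>n, ..., 2 n - 2\<close>, so the bipartite count applies; vertex \<open>u\<close> has
  \<open>n - u\<close> inner edges and contributes a simplex of that dimension.\<close>

lemma normalized_volume_limiting:
  assumes "2 \<le> n"
  shows "normalized_volume (limiting_flow_polytope (rev [1..<n]) (\<lambda>_. 1))
    = fact (n choose 2) * (1 / (\<Prod>i=1..<n. fact i))"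
proof -
  \<comment> \<open>Number of parts plus largest part, both \<open>n - 1\<close>. Part
    \<open>i\<close> is \<open>n - i\<close>, so its edges start at
    \<open>m + 1 - (n - i) = n - 1 + i\<close>.\<close>
  define m where "m = 2 * n - 2"
  define E where "E = (SIGMA i:{1..<n}. {n - 1 + i..m})"
  interpret inner_graph m E
    by unfold_locales (auto simp: E_def m_def)
  have nth: "rev [1..<n] ! (i - 1) = n - i" if "i \<in> {1..n - 1}" for i
    using that by (subst rev_nth) auto
  have len: "length (rev [1..<n]) + rev [1..<n] ! 0 = m"
    using nth[of 1] assms by (simp add: m_def)
  have "partition_edges (rev [1..<n]) m = G"
  proof -
    have "{(i, j). i \<in> {1..length (rev [1..<n])} \<and> m + 1 - rev [1..<n] ! (i - 1) \<le> j \<and> j \<le> m} = E"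
      using nth by (auto simp: E_def m_def)
    moreover have "{(i, m + 1) | i. i \<in> {1..m}} = (\<lambda>i. (i, m + 1)) ` {1..m}"
      by auto
    ultimately show ?thesis
      unfolding partition_edges_def G_def by (simp only: Un_commute)
  qed
  then have poly: "limiting_flow_polytope (rev [1..<n]) (\<lambda>_. 1) = flow_polytope m G (\<lambda>_. 1)"
    unfolding limiting_flow_polytope_def len Let_def by simp
  have deg: "card {e \<in> E. fst e = u} = n - u" if "u \<in> {1..<n}" for u
  proof -
    have "{e \<in> E. fst e = u} = {u} \<times> {n - 1 + u..m}"
      using that by (auto simp: E_def)
    then have "card {e \<in> E. fst e = u} = Suc m - (n - 1 + u)"
      by (simp add: card_cartesian_product)
    also have "\<dots> = n - u"
      using that assms unfolding m_def by auto
    finally show ?thesis .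
  qed
  have rev: "(\<Prod>u=1..<n. g (n - u)) = (\<Prod>k=1..<n. g k)" for g :: "nat \<Rightarrow> nat"
    by (rule prod.reindex_bij_witness[of _ "\<lambda>k. n - k" "\<lambda>k. n - k"]) auto
  have sum: "(\<Sum>k=1..<n. k) = n choose 2"
  proof (induction n)
    case (Suc n)
    then show ?case by (cases n) (auto simp: numeral_2_eq_2)
  qed simp
  have "card E = (\<Sum>u=1..<n. n - u)"
    unfolding E_def by (subst card_SigmaI) (auto simp: m_def intro!: sum.cong)
  also have "\<dots> = (\<Sum>k=1..<n. k)"
    by (rule sum.reindex_bij_witness[of _ "\<lambda>k. n - k" "\<lambda>k. n - k"]) auto
  finally have card: "card E = n choose 2"
    using sum by simp
  have count: "card (routings E (\<lambda>_. t)) = (\<Prod>k=1..<n. (t + k) choose k)" for t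
  proof -
    have "card (routings E (\<lambda>_. t)) = (\<Prod>u=1..<n. (t + card {e \<in> E. fst e = u}) choose card {e \<in> E. fst e = u})"
      using card_routings_bipartite[OF finite_E, of "{1..<n}"] by (force simp: E_def)
    also have "\<dots> = (\<Prod>u=1..<n. (t + (n - u)) choose (n - u))"
      by (intro prod.cong refl) (simp add: deg)
    also have "\<dots> = (\<Prod>k=1..<n. (t + k) choose k)"
      by (rule rev)
    finally show ?thesis .
  qed
  have "(\<lambda>t. \<Prod>k=1..<n. real ((t + k) choose k) / real t ^ k) \<longlonglongrightarrow> (\<Prod>k=1..<n. 1 / fact k)"
    by (intro tendsto_prod choose_tendsto)
  then have "(\<lambda>t. real (card (routings E (\<lambda>_. t))) / real t ^ (n choose 2)) \<longlonglongrightarrow> 1 / (\<Prod>k=1..<n. fact k)"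
    by (simp add: count prod_dividef power_sum[symmetric] sum[symmetric])
  from normalized_volume_flow_polytope[OF this] show ?thesis
    unfolding poly using card by simp
qed

theorem corollary1p3:
  fixes n :: nat
  assumes "n \<ge> 2"
  shows "normalized_volume (flow_polytope n (complete_edges (n + 1)) (\<lambda>_. 1))
    = 2 ^ (n choose 2) / fact n
      * normalized_volume (limiting_flow_polytope (rev [1..<n]) (\<lambda>_. 1))"
proof -
  \<comment> \<open>The two products of factorials differ by the factor \<open>n!\<close>, the
    denominator of the claim.\<close>
  have "{1..n} = insert n {1..<n}"
    using assms by auto
  then have "(\<Prod>i=1..n. fact i) = fact n * (\<Prod>i=1..<n. fact i :: real)"
    by simp
  then show ?thesis
    unfolding normalized_volume_complete normalized_volume_limiting[OF assms] by simp
qed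

end
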